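(* If $\gamma_1,\gamma_2>0$ and $t\in[0,1)$, then $$\mathbb{E}\Bigl\langle \bigl(Q_{1,1}-\langle Q_{1,1}\rangle\bigr)^2\Bigr\rangle \leq \frac{4(\gamma_1+\gamma_2)}{\gamma_1\gamma_2\sqrt{|E|(1-t)}}.$$
   Context: Let $(\Sigma,\mathcal{F})$ be a measurable space, $E$ a fixed finite nonempty index set, and $(f_e)_{e\in E}$ a family of measurable functions $f_e:\Sigma\to[-1,1]$. Let $(g_e^1,g_e^2)$, $e\in E$, be independent (over $e$) centered jointly Gaussian random pairs with $\mathbb{E}(g_e^1)^2=\mathbb{E}(g_e^2)^2=1$ and $\mathbb{E}g_e^1g_e^2=t$. Define the Hamiltonians, for $\sigma,\rho\in\Sigma$, $$Y_1(\sigma)=\sum_{e\in E}g_e^1f_e(\sigma),\qquad Y_2(\rho)=\sum_{e\in E}g_e^2f_e(\rho).$$ Let $\gamma_1,\gamma_2>0$ be constants and let $\mu_1,\mu_2$ be (possibly random) finite nonzero measures on $(\Sigma,\mathcal{F})$. The functions $f_e$ are also allowed to be random. All the randomness of $(f_e)_{e\in E}$, $\mu_1$, $\mu_2$ is independent of the Gaussian variables $(g_e^1,g_e^2)_{e\in E}$, but $\mu_1,\mu_2$ and $(f_e)$ need not be independent of each other. The Gibbs measures are $$dG_1(\sigma)=\frac{\exp(\gamma_1Y_1(\sigma))}{Z_1}\,d\mu_1(\sigma),\qquad dG_2(\rho)=\frac{\exp(\gamma_2Y_2(\rho))}{Z_2}\,d\mu_2(\rho),$$ where $Z_1,Z_2$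 are the normalizing constants making $G_1,G_2$ probability measures. Let $(\sigma^\ell)_{\ell\ge1}$ be i.i.d. samples from $G_1$ and $(\rho^\ell)_{\ell\ge1}$ i.i.d. samples from $G_2$ (independent of each other given all the disorder), and let $\langle\,\cdot\,\rangle$ denote the average with respect to $(G_1\times G_2)^{\otimes\infty}$. $\mathbb{E}$ denotes expectation over all the disorder. The overlaps are $$Q_{\ell,\ell'}=\frac{1}{|E|}\sum_{e\in E}f_e(\sigma^\ell)f_e(\rho^{\ell'}).$$ *)

theory Defs
  imports "HOL-Probability.Probability"
begin

text \<open>
  A real random pair is jointly Gaussian if its law is the image of the standard Gaussian measure
  on the plane under an affine map. Degenerate laws are included.
\<close>

definition jointly_gaussian :: "'w measure \<Rightarrow> ('w \<Rightarrow> real) \<Rightarrow> ('w \<Rightarrow> real) \<Rightarrow> bool" where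
  "jointly_gaussian M X Y \<longleftrightarrow>
     X \<in> borel_measurable M \<and> Y \<in> borel_measurable M \<and>
     (\<exists>m\<^sub>1 m\<^sub>2 a b c d.
        distr M (borel \<Otimes>\<^sub>M borel) (\<lambda>\<omega>. (X \<omega>, Y \<omega>)) =
        distr (density lborel std_normal_density \<Otimes>\<^sub>M density lborel std_normal_density)
          (borel \<Otimes>\<^sub>M borel)
          (\<lambda>(x, y). (m\<^sub>1 + a * x + b * y, m\<^sub>2 + c * x + d * y)))"

text \<open>
  A random finite nonzero measure on \<open>S\<close> whose randomness is carried by the
  \<open>\<sigma>\<close>-algebra of \<open>R\<close>. The library's \<open>subprob_algebra\<close> does not apply, since the total mass
  may exceed 1.
\<close>

definition random_finite_measure :: "'w measure \<Rightarrow> 's measure \<Rightarrow> ('w \<Rightarrow> 's measure) \<Rightarrow> bool" where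
  "random_finite_measure R S \<mu> \<longleftrightarrow>
     (\<forall>\<omega>\<in>space R. sets (\<mu> \<omega>) = sets S \<and> finite_measure (\<mu> \<omega>) \<and> emeasure (\<mu> \<omega>) (space S) \<noteq> 0) \<and>
     (\<forall>A\<in>sets S. (\<lambda>\<omega>. emeasure (\<mu> \<omega>) A) \<in> borel_measurable R)"

definition hamiltonian :: "'e set \<Rightarrow> ('e \<Rightarrow> real) \<Rightarrow> ('e \<Rightarrow> 's \<Rightarrow> real) \<Rightarrow> 's \<Rightarrow> real" where
  "hamiltonian E g f \<sigma> = (\<Sum>e\<in>E. g e * f e \<sigma>)"

definition partition_function :: "real \<Rightarrow> ('s \<Rightarrow> real) \<Rightarrow> 's measure \<Rightarrow> real" where
  "partition_function \<gamma> H \<mu> = (\<integral>\<sigma>. exp (\<gamma> * H \<sigma>) \<partial>\<mu>)"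

definition gibbs_measure :: "real \<Rightarrow> ('s \<Rightarrow> real) \<Rightarrow> 's measure \<Rightarrow> 's measure" where
  "gibbs_measure \<gamma> H \<mu> =
     density \<mu> (\<lambda>\<sigma>. ennreal (exp (\<gamma> * H \<sigma>) / partition_function \<gamma> H \<mu>))"

text \<open>
  A sample \<open>s\<close> from \<open>(G\<^sub>1 \<times> G\<^sub>2)\<^bsup>\<otimes>\<infinity>\<^esup>\<close> consists of the pairs of replicas
  \<open>s l = (\<sigma>\<^sup>l, \<rho>\<^sup>l)\<close>, \<open>l \<ge> 1\<close>.
\<close>

definition gibbs_average ::
  "'s measure \<Rightarrow> 's measure \<Rightarrow> ((nat \<Rightarrow> 's \<times> 's) \<Rightarrow> real) \<Rightarrow> real" where
  "gibbs_average G\<^sub>1 G\<^sub>2 F = (\<integral>s. F s \<partial>(\<Pi>\<^sub>M l\<in>{1..}. G\<^sub>1 \<Otimes>\<^sub>M G\<^sub>2))"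

definition overlap ::
  "'e set \<Rightarrow> ('e \<Rightarrow> 's \<Rightarrow> real) \<Rightarrow> nat \<Rightarrow> nat \<Rightarrow> (nat \<Rightarrow> 's \<times> 's) \<Rightarrow> real" where
  "overlap E f l l' s = 1 / real (card E) * (\<Sum>e\<in>E. f e (fst (s l)) * f e (snd (s l')))"

end

theory Submission
  imports Defs "HOL-Real_Asymp.Real_Asymp"
begin

text \<open>
  Put \<open>w e = g\<^sub>1 e - t * g\<^sub>2 e\<close>, which is uncorrelated with \<open>g\<^sub>2 e\<close> and has variance \<open>1 - t\<^sup>2\<close>.
  Gaussian integration by parts in the disorder gives, with \<open>N = |E|\<close>,
  \<open>N (1 - t\<^sup>2) \<gamma>\<^sub>1 \<cdot> E \<langle>Q\<^sub>1\<^sub>1\<^sup>2 - Q\<^sub>1\<^sub>1 Q\<^sub>2\<^sub>1\<rangle> = E \<langle>(\<Sum>e. w e * f e (\<rho>\<^sup>1)) Q\<^sub>1\<^sub>1\<rangle>\<close>. Since \<open>G\<^sub>2\<close> depends on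
  \<open>g\<^sub>2\<close> only, the sum on the right is Gaussian given \<open>\<rho>\<^sup>1\<close>, with standard deviation at most
  \<open>\<theta> = sqrt (N (1 - t\<^sup>2))\<close>, so the right-hand side is at most \<open>\<theta>\<close> as \<open>|Q\<^sub>1\<^sub>1| \<le> 1\<close>. By symmetry the
  same holds for \<open>Q\<^sub>1\<^sub>1\<^sup>2 - Q\<^sub>1\<^sub>1 Q\<^sub>1\<^sub>2\<close>, and the two quantities together dominate the variance of
  \<open>Q\<^sub>1\<^sub>1\<close> because the sum over \<open>e, e'\<close> of the products of the covariances of \<open>f e, f e'\<close> under
  \<open>G\<^sub>1\<close> and under \<open>G\<^sub>2\<close> is nonnegative.
\<close>

section \<open>Gaussian integration by parts\<close>

text \<open>The obstacle is that integration by parts in \<open>g\<^sub>1 e\<close> alone also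
  differentiates \<open>G\<^sub>2\<close>, because the two Gaussians are correlated; the identity
  then mixes a term in the covariances under \<open>G\<^sub>2\<close> with the wanted one.
  Subtracting \<open>t * g\<^sub>2 e\<close> removes that term, at the price of the factor
  \<open>1 - t\<^sup>2\<close>, which degenerates as t tends to 1. The bound on the weighted sum
  uses second moments only. Weights at distinct sites stay orthogonal after multiplication by a
  \<open>G\<^sub>2\<close>-average: integration by parts with the constant observable 1 produces the
  covariance of a constant under \<open>G\<^sub>1\<close>, which is 0. Cauchy-Schwarz is replaced by
  the arithmetic-geometric mean inequality with parameter \<theta>, so that only sums over pairs of
  sites have to be integrated. Since \<open>f\<close> and the base measures are random, every
  integration by parts takes place in a single Gaussian pair with all other disorder frozen. The
  argument reaches the constant 1 in place of 4; the factor 1 - t of the bound comes from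
  \<open>1 - t \<le> 1 - t\<^sup>2\<close>.\<close>

lemma integrable_std_normal_density: "integrable lborel std_normal_density"
  using integrable_std_normal_moment[of 0] by simp

text \<open>Since the density \<rho> satisfies \<rho>' = - x \<rho>, the integrand of the difference
  is the derivative of \<rho> \<phi>, and \<rho> \<phi> vanishes at both infinities. Boundedness
  gives integrability of both terms; continuity of \<open>\<phi>'\<close> serves the fundamental
  theorem of calculus on the whole line.\<close>

lemma std_gaussian_integration_by_parts:
  fixes \<phi> \<phi>' :: "real \<Rightarrow> real"
  assumes deriv: "\<And>x. (\<phi> has_real_derivative \<phi>' x) (at x)"
    and cont: "continuous_on UNIV \<phi>'"
    and bnd: "\<And>x. \<bar>\<phi> x\<bar> \<le> C" and bnd': "\<And>x. \<bar>\<phi>' x\<bar> \<le> C"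
  shows "(\<integral>x. x * \<phi> x \<partial>std_normal_distribution) = (\<integral>x. \<phi>' x \<partial>std_normal_distribution)"
proof -
  let ?\<rho> = "std_normal_density"
  have cont\<phi>: "continuous_on UNIV \<phi>"
    using deriv by (intro continuous_at_imp_continuous_on) (auto intro: DERIV_isCont)
  have [measurable]: "\<phi> \<in> borel_measurable borel" "\<phi>' \<in> borel_measurable borel"
    using cont cont\<phi> by (auto intro: borel_measurable_continuous_onI)
  define \<psi> where "\<psi> x = ?\<rho> x * \<phi>' x - ?\<rho> x * (x * \<phi> x)" for x
  have d\<rho>: "(?\<rho> has_real_derivative - (?\<rho> x * x)) (at x)" for x
  proof -
    have "((\<lambda>x. k * exp (- x\<^sup>2 / 2)) has_real_derivative - (k * exp (- x\<^sup>2 / 2) * x)) (at x)" for k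
      by (auto intro!: derivative_eq_intros)
    then show ?thesis unfolding std_normal_density_def .
  qed
  have dF: "((\<lambda>x. ?\<rho> x * \<phi> x) has_real_derivative \<psi> x) (at x)" for x
    unfolding \<psi>_def by (auto intro!: derivative_eq_intros d\<rho> deriv simp: algebra_simps)
  have C: "0 \<le> C" using bnd[of 0] by linarith
  have i1: "integrable lborel (\<lambda>x. ?\<rho> x * \<phi>' x)"
    by (rule Bochner_Integration.integrable_bound[of _ "\<lambda>x. C * ?\<rho> x"])
      (use C bnd' integrable_std_normal_density in \<open>auto simp: abs_mult mult.commute intro!: mult_right_mono\<close>)
  have i2: "integrable lborel (\<lambda>x. ?\<rho> x * (x * \<phi> x))"
  proof (rule Bochner_Integration.integrable_bound[of _ "\<lambda>x. C * (?\<rho> x * \<bar>x\<bar>)"])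
    show "integrable lborel (\<lambda>x. C * (?\<rho> x * \<bar>x\<bar>))"
      using integrable_std_normal_moment_abs[of 1] by simp
    show "AE x in lborel. norm (?\<rho> x * (x * \<phi> x)) \<le> norm (C * (?\<rho> x * \<bar>x\<bar>))"
    proof (rule AE_I2)
      fix x
      have "(?\<rho> x * \<bar>x\<bar>) * \<bar>\<phi> x\<bar> \<le> (?\<rho> x * \<bar>x\<bar>) * C"
        using bnd by (intro mult_left_mono) auto
      then show "norm (?\<rho> x * (x * \<phi> x)) \<le> norm (C * (?\<rho> x * \<bar>x\<bar>))"
        using C by (simp add: abs_mult algebra_simps)
    qed
  qed auto
  have lim: "(?\<rho> \<longlongrightarrow> 0) at_top" "(?\<rho> \<longlongrightarrow> 0) at_bot"
    unfolding std_normal_density_def by real_asymp+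
  have lim': "((\<lambda>x. ?\<rho> x * \<phi> x) \<longlongrightarrow> 0) F" if "(?\<rho> \<longlongrightarrow> 0) F" for F
  proof (rule Lim_null_comparison)
    show "\<forall>\<^sub>F x in F. norm (?\<rho> x * \<phi> x) \<le> ?\<rho> x * C"
      using bnd by (intro always_eventually) (auto simp: abs_mult intro!: mult_left_mono)
    show "((\<lambda>x. ?\<rho> x * C) \<longlongrightarrow> 0) F" using tendsto_mult_left_zero[OF that] by simp
  qed
  have "(LBINT x=-\<infinity>..\<infinity>. \<psi> x) = 0 - 0"
  proof (rule interval_integral_FTC_integrable)
    show "((\<lambda>x. ?\<rho> x * \<phi> x) has_vector_derivative \<psi> x) (at x)" for x
      using dF by (simp add: has_real_derivative_iff_has_vector_derivative)
    show "isCont \<psi> x" for x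
      using cont cont\<phi> unfolding \<psi>_def std_normal_density_def
      by (auto intro!: continuous_intros simp: continuous_on_eq_continuous_at)
    show "set_integrable lborel (einterval (-\<infinity>) \<infinity>) \<psi>"
      unfolding \<psi>_def using i1 i2 by (simp add: set_integrable_def)
    show "(((\<lambda>x. ?\<rho> x * \<phi> x) \<circ> real_of_ereal) \<longlongrightarrow> 0) (at_right (-\<infinity>))"
      using lim'[OF lim(2)] by (simp add: ereal_tendsto_simps)
    show "(((\<lambda>x. ?\<rho> x * \<phi> x) \<circ> real_of_ereal) \<longlongrightarrow> 0) (at_left \<infinity>)"
      using lim'[OF lim(1)] by (simp add: ereal_tendsto_simps)
  qed simp
  then have "(\<integral>x. \<psi> x \<partial>lborel) = 0"
    by (simp add: interval_lebesgue_integral_def set_lebesgue_integral_def)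
  then have "(\<integral>x. ?\<rho> x * \<phi>' x \<partial>lborel) = (\<integral>x. ?\<rho> x * (x * \<phi> x) \<partial>lborel)"
    unfolding \<psi>_def using i1 i2 by simp
  then show ?thesis
    using integral_density[of "\<lambda>x. x * \<phi> x" lborel ?\<rho>] integral_density[of \<phi>' lborel ?\<rho>]
    by simp
qed

text \<open>Differentiation under the integral by dominated convergence of the difference quotients.
  The summand \<open>c\<close> will hold the part of the Hamiltonian that stays fixed while one
  coupling moves.\<close>

lemma has_real_derivative_integral_exp:
  fixes h F c :: "'a \<Rightarrow> real"
  assumes "finite_measure \<mu>"
    and [measurable]: "h \<in> borel_measurable \<mu>" "F \<in> borel_measurable \<mu>" "c \<in> borel_measurable \<mu>"
    and h: "\<And>\<sigma>. \<sigma> \<in> space \<mu> \<Longrightarrow> \<bar>h \<sigma>\<bar> \<le> B"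
    and F: "\<And>\<sigma>. \<sigma> \<in> space \<mu> \<Longrightarrow> \<bar>F \<sigma>\<bar> \<le> K"
    and c: "\<And>\<sigma>. \<sigma> \<in> space \<mu> \<Longrightarrow> \<bar>c \<sigma>\<bar> \<le> C"
  shows "((\<lambda>x. \<integral>\<sigma>. h \<sigma> * exp (x * F \<sigma> + c \<sigma>) \<partial>\<mu>) has_real_derivative
           (\<integral>\<sigma>. h \<sigma> * F \<sigma> * exp (x * F \<sigma> + c \<sigma>) \<partial>\<mu>)) (at x)"
proof -
  interpret finite_measure \<mu> by fact
  have expb: "exp (y * F \<sigma> + c \<sigma>) \<le> exp (L * K + C)" if "\<sigma> \<in> space \<mu>" "\<bar>y\<bar> \<le> L" for y L \<sigma>
  proof -
    have "\<bar>y * F \<sigma>\<bar> \<le> L * K"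
      unfolding abs_mult using F[OF that(1)] that(2) by (intro mult_mono) auto
    then show ?thesis using c[OF that(1)] by simp
  qed
  have int: "integrable \<mu> (\<lambda>\<sigma>. h \<sigma> * exp (y * F \<sigma> + c \<sigma>))" for y
  proof (rule integrable_const_bound[where B="B * exp (\<bar>y\<bar> * K + C)"])
    show "AE \<sigma> in \<mu>. norm (h \<sigma> * exp (y * F \<sigma> + c \<sigma>)) \<le> B * exp (\<bar>y\<bar> * K + C)"
    proof (rule AE_I2)
      fix \<sigma> assume s: "\<sigma> \<in> space \<mu>"
      show "norm (h \<sigma> * exp (y * F \<sigma> + c \<sigma>)) \<le> B * exp (\<bar>y\<bar> * K + C)"
        using h[OF s] expb[OF s order_refl, of y] by (auto simp: abs_mult intro!: mult_mono)
    qed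
  qed simp
  \<comment> \<open>A mean value estimate from \<open>1 - exp (b - a) \<le> a - b\<close>; any
    common upper bound \<open>L\<close> of the two exponentials serves as Lipschitz
    constant.\<close>
  have lip: "\<bar>exp a - exp b\<bar> \<le> \<bar>a - b\<bar> * L" if "exp a \<le> L" "exp b \<le> L" for a b L :: real
  proof -
    have *: "exp a - exp b \<le> \<bar>a - b\<bar> * L" if "exp a \<le> L" for a b :: real
    proof (cases "b \<le> a")
      case True
      have "1 - exp (b - a) \<le> a - b" using exp_ge_add_one_self[of "b - a"] by linarith
      then have "exp a * (1 - exp (b - a)) \<le> exp a * (a - b)" by (intro mult_left_mono) auto
      then have "exp a - exp b \<le> exp a * (a - b)"
        by (simp add: right_diff_distrib exp_add[symmetric])
      also have "\<dots> \<le> L * (a - b)" using that True by (intro mult_right_mono) auto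
      finally show ?thesis using True by (simp add: mult.commute)
    next
      case False
      then have "exp a - exp b \<le> 0" by simp
      moreover have "0 \<le> \<bar>a - b\<bar> * L"
        using that exp_gt_zero[of a] by (intro mult_nonneg_nonneg) linarith+
      ultimately show ?thesis by linarith
    qed
    show ?thesis using *[of a b] *[of b a] that by (auto simp: abs_minus_commute)
  qed
  show ?thesis
    unfolding has_field_derivative_iff tendsto_at_iff_sequentially comp_def
  proof (intro allI impI)
    fix X :: "nat \<Rightarrow> real" assume X: "\<forall>i. X i \<in> UNIV - {x}" "X \<longlonglongrightarrow> x"
    then have ne: "X i \<noteq> x" for i by auto
    \<comment> \<open>A convergent sequence is bounded, and \<open>L\<close> bounds its limit too,
      so one constant dominates all difference quotients.\<close>
    obtain L where L: "\<bar>X i\<bar> \<le> L" for i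
      using convergent_imp_Bseq[of X] X(2) by (auto simp: convergent_def Bseq_def)
    have Lx: "\<bar>x\<bar> \<le> L"
      using L by (intro tendsto_upperbound[OF tendsto_rabs[OF X(2)]]) auto
    let ?s = "\<lambda>i \<sigma>. h \<sigma> * ((exp (X i * F \<sigma> + c \<sigma>) - exp (x * F \<sigma> + c \<sigma>)) / (X i - x))"
    have "(\<lambda>i. \<integral>\<sigma>. ?s i \<sigma> \<partial>\<mu>) \<longlonglongrightarrow> (\<integral>\<sigma>. h \<sigma> * F \<sigma> * exp (x * F \<sigma> + c \<sigma>) \<partial>\<mu>)"
    proof (rule integral_dominated_convergence[where w="\<lambda>_. B * (K * exp (L * K + C))"])
      show "AE \<sigma> in \<mu>. (\<lambda>i. ?s i \<sigma>) \<longlonglongrightarrow> h \<sigma> * F \<sigma> * exp (x * F \<sigma> + c \<sigma>)"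
      proof (rule AE_I2)
        fix \<sigma>
        have "((\<lambda>x. exp (x * F \<sigma> + c \<sigma>)) has_real_derivative F \<sigma> * exp (x * F \<sigma> + c \<sigma>)) (at x)"
          by (auto intro!: derivative_eq_intros)
        then have "(\<lambda>i. (exp (X i * F \<sigma> + c \<sigma>) - exp (x * F \<sigma> + c \<sigma>)) / (X i - x))
            \<longlonglongrightarrow> F \<sigma> * exp (x * F \<sigma> + c \<sigma>)"
          unfolding has_field_derivative_iff tendsto_at_iff_sequentially comp_def using X by blast
        from tendsto_mult_left[OF this, of "h \<sigma>"]
        show "(\<lambda>i. ?s i \<sigma>) \<longlonglongrightarrow> h \<sigma> * F \<sigma> * exp (x * F \<sigma> + c \<sigma>)" by (simp add: mult.assoc)
      qed
      show "AE \<sigma> in \<mu>. norm (?s i \<sigma>) \<le> B * (K * exp (L * K + C))" for i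
      proof (rule AE_I2)
        fix \<sigma> assume s: "\<sigma> \<in> space \<mu>"
        have "\<bar>exp (X i * F \<sigma> + c \<sigma>) - exp (x * F \<sigma> + c \<sigma>)\<bar>
            \<le> \<bar>(X i * F \<sigma> + c \<sigma>) - (x * F \<sigma> + c \<sigma>)\<bar> * exp (L * K + C)"
          by (rule lip) (use expb[OF s] L Lx in auto)
        also have "\<dots> = \<bar>X i - x\<bar> * (\<bar>F \<sigma>\<bar> * exp (L * K + C))"
          by (simp add: left_diff_distrib[symmetric] abs_mult)
        also have "\<dots> \<le> \<bar>X i - x\<bar> * (K * exp (L * K + C))"
          using F[OF s] by (intro mult_left_mono mult_right_mono) auto
        finally have "\<bar>(exp (X i * F \<sigma> + c \<sigma>) - exp (x * F \<sigma> + c \<sigma>)) / (X i - x)\<bar>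
            \<le> K * exp (L * K + C)"
          using ne[of i] by (simp add: abs_divide field_simps)
        then show "norm (?s i \<sigma>) \<le> B * (K * exp (L * K + C))"
          using h[OF s] unfolding real_norm_def abs_mult by (intro mult_mono) auto
      qed
    qed auto
    moreover have "(\<integral>\<sigma>. ?s i \<sigma> \<partial>\<mu>) = ((\<integral>\<sigma>. h \<sigma> * exp (X i * F \<sigma> + c \<sigma>) \<partial>\<mu>)
        - (\<integral>\<sigma>. h \<sigma> * exp (x * F \<sigma> + c \<sigma>) \<partial>\<mu>)) / (X i - x)" for i
    proof -
      have "(\<integral>\<sigma>. ?s i \<sigma> \<partial>\<mu>) = (\<integral>\<sigma>. (h \<sigma> * exp (X i * F \<sigma> + c \<sigma>) - h \<sigma> * exp (x * F \<sigma> + c \<sigma>)) / (X i - x) \<partial>\<mu>)"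
        by (simp add: right_diff_distrib)
      then show ?thesis using int by simp
    qed
    ultimately show "(\<lambda>i. ((\<integral>\<sigma>. h \<sigma> * exp (X i * F \<sigma> + c \<sigma>) \<partial>\<mu>)
        - (\<integral>\<sigma>. h \<sigma> * exp (x * F \<sigma> + c \<sigma>) \<partial>\<mu>)) / (X i - x))
        \<longlonglongrightarrow> (\<integral>\<sigma>. h \<sigma> * F \<sigma> * exp (x * F \<sigma> + c \<sigma>) \<partial>\<mu>)" by (simp only:)
  qed
qed

section \<open>Gaussian laws on the plane and correlated pairs\<close>

lemma pair_prob_space_std_normal: "pair_prob_space std_normal_distribution std_normal_distribution"
proof -
  interpret real_distribution std_normal_distribution by (rule real_dist_normal_dist)
  show ?thesis by unfold_locales
qed

abbreviation (input) std_normal_plane :: "(real \<times> real) measure" where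
  "std_normal_plane \<equiv> std_normal_distribution \<Otimes>\<^sub>M std_normal_distribution"

lemma std_normal_plane_moments:
  shows "integrable std_normal_plane (\<lambda>z. fst z ^ k)" "integrable std_normal_plane (\<lambda>z. snd z ^ k)"
    and "(\<integral>z. fst z ^ k \<partial>std_normal_plane) = (\<integral>x. x ^ k \<partial>std_normal_distribution)"
    and "(\<integral>z. snd z ^ k \<partial>std_normal_plane) = (\<integral>x. x ^ k \<partial>std_normal_distribution)"
    and "integrable std_normal_plane (\<lambda>z. fst z * snd z)"
    and "(\<integral>z. fst z * snd z \<partial>std_normal_plane) = 0"
proof -
  interpret N: real_distribution std_normal_distribution by (rule real_dist_normal_dist)
  interpret P: pair_prob_space std_normal_distribution std_normal_distribution
    by (rule pair_prob_space_std_normal)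
  let ?G = "std_normal_distribution"
  have fst: "distr std_normal_plane ?G fst = ?G" by (rule N.distr_pair_fst)
  \<comment> \<open>Exchanging the coordinates preserves the product measure, so the second marginal
    equals the first.\<close>
  have "distr std_normal_plane ?G snd = distr (distr std_normal_plane std_normal_plane (\<lambda>(x, y). (y, x))) ?G snd"
    using P.distr_pair_swap by simp
  also have "\<dots> = distr std_normal_plane ?G fst"
    by (subst distr_distr) (auto simp: comp_def case_prod_beta)
  finally have snd: "distr std_normal_plane ?G snd = ?G" by (simp only: fst)
  show i1: "integrable std_normal_plane (\<lambda>z. fst z ^ k)" for k
    using integrable_distr[of fst std_normal_plane ?G "\<lambda>x. x ^ k"]
      integrable_std_normal_distribution_moment[of k] by (simp add: fst)
  show i2: "integrable std_normal_plane (\<lambda>z. snd z ^ k)" for k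
    using integrable_distr[of snd std_normal_plane ?G "\<lambda>x. x ^ k"]
      integrable_std_normal_distribution_moment[of k] by (simp add: snd)
  show "(\<integral>z. fst z ^ k \<partial>std_normal_plane) = (\<integral>x. x ^ k \<partial>?G)"
    by (subst (2) fst[symmetric], subst integral_distr) auto
  show "(\<integral>z. snd z ^ k \<partial>std_normal_plane) = (\<integral>x. x ^ k \<partial>?G)"
    by (subst (2) snd[symmetric], subst integral_distr) auto
  show i: "integrable std_normal_plane (\<lambda>z. fst z * snd z)"
  proof (rule Bochner_Integration.integrable_bound[of _ "\<lambda>z. (fst z)\<^sup>2 + (snd z)\<^sup>2"])
    show "AE z in std_normal_plane. norm (fst z * snd z) \<le> norm ((fst z)\<^sup>2 + (snd z)\<^sup>2)"
    proof (rule AE_I2)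
      fix z :: "real \<times> real"
      show "norm (fst z * snd z) \<le> norm ((fst z)\<^sup>2 + (snd z)\<^sup>2)"
        using sum_squares_bound[of "\<bar>fst z\<bar>" "\<bar>snd z\<bar>"]
          mult_nonneg_nonneg[OF abs_ge_zero abs_ge_zero, of "fst z" "snd z"]
        by (simp add: abs_mult del: mult_nonneg_nonneg)
    qed
  qed (use i1 i2 in auto)
  have "(\<integral>z. fst z * snd z \<partial>std_normal_plane) = (\<integral>x. (\<integral>y. x * y \<partial>?G) \<partial>?G)"
    using P.integral_fst'[OF i] by simp
  also have "\<dots> = 0"
    using integral_std_normal_distribution_moment_odd[of 1] by simp
  finally show "(\<integral>z. fst z * snd z \<partial>std_normal_plane) = 0" .
qed

lemma std_normal_plane_affine:
  shows "(\<integral>z. m + a * fst z + b * snd z \<partial>std_normal_plane) = m"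
    and "(\<integral>z. (a * fst z + b * snd z) * (c * fst z + d * snd z) \<partial>std_normal_plane) = a * c + b * d"
    and "integrable std_normal_plane (\<lambda>z. a * fst z + b * snd z)"
proof -
  interpret P: pair_prob_space std_normal_distribution std_normal_distribution
    by (rule pair_prob_space_std_normal)
  note i = std_normal_plane_moments(1,2)[of 1] std_normal_plane_moments(1,2)[of 2]
    std_normal_plane_moments(5)
  note e = std_normal_plane_moments(3,4)[of 1] std_normal_plane_moments(3,4)[of 2]
    std_normal_plane_moments(6) std_normal_distribution_even_moments(1)[of 1]
    integral_std_normal_distribution_moment_odd[of 1]
  show "(\<integral>z. m + a * fst z + b * snd z \<partial>std_normal_plane) = m"
    using i e by (simp add: P.prob_space)
  have "(\<integral>z. (a * fst z + b * snd z) * (c * fst z + d * snd z) \<partial>std_normal_plane)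
      = (\<integral>z. (a * c) * (fst z)\<^sup>2 + (b * d) * (snd z)\<^sup>2 + (a * d + b * c) * (fst z * snd z) \<partial>std_normal_plane)"
    by (intro Bochner_Integration.integral_cong) (auto simp: power2_eq_square algebra_simps)
  also have "\<dots> = a * c + b * d"
    using i e by (simp add: numeral_2_eq_2)
  finally show "(\<integral>z. (a * fst z + b * snd z) * (c * fst z + d * snd z) \<partial>std_normal_plane) = a * c + b * d" .
  show "integrable std_normal_plane (\<lambda>z. a * fst z + b * snd z)"
    using i by simp
qed

text \<open>The one-dimensional formula along each axis, followed by Fubini: a move in the first
  coordinate shifts \<open>u\<close> at rate \<open>a\<close> and \<open>v\<close> at rate
  \<open>c\<close>, a move in the second at rates \<open>b\<close> and \<open>d\<close>. The two
  coefficients on the right are the covariances of the linear form with \<open>u\<close> and with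
  \<open>v\<close>.\<close>

lemma std_normal_plane_integration_by_parts:
  fixes \<phi> \<phi>' \<psi> \<psi>' :: "real \<Rightarrow> real" and a b c d p q :: real
  assumes d\<phi>: "\<And>x. (\<phi> has_real_derivative \<phi>' x) (at x)" and c\<phi>: "continuous_on UNIV \<phi>'"
    and d\<psi>: "\<And>x. (\<psi> has_real_derivative \<psi>' x) (at x)" and c\<psi>: "continuous_on UNIV \<psi>'"
    and b: "\<And>x. \<bar>\<phi> x\<bar> \<le> C" "\<And>x. \<bar>\<phi>' x\<bar> \<le> C" "\<And>x. \<bar>\<psi> x\<bar> \<le> C" "\<And>x. \<bar>\<psi>' x\<bar> \<le> C"
  defines "u \<equiv> \<lambda>z. a * fst z + b * snd z" and "v \<equiv> \<lambda>z. c * fst z + d * snd z"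
  shows "(\<integral>z. (p * fst z + q * snd z) * (\<phi> (u z) * \<psi> (v z)) \<partial>std_normal_plane) =
      (p * a + q * b) * (\<integral>z. \<phi>' (u z) * \<psi> (v z) \<partial>std_normal_plane)
      + (p * c + q * d) * (\<integral>z. \<phi> (u z) * \<psi>' (v z) \<partial>std_normal_plane)"
proof -
  interpret P: pair_prob_space std_normal_distribution std_normal_distribution
    by (rule pair_prob_space_std_normal)
  let ?G = "std_normal_distribution"
  have cont\<phi>: "continuous_on UNIV \<phi>" and cont\<psi>: "continuous_on UNIV \<psi>"
    using d\<phi> d\<psi> by (auto intro!: continuous_at_imp_continuous_on intro: DERIV_isCont)
  have [measurable]: "\<phi> \<in> borel_measurable borel" "\<phi>' \<in> borel_measurable borel"
    "\<psi> \<in> borel_measurable borel" "\<psi>' \<in> borel_measurable borel"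
    using c\<phi> c\<psi> cont\<phi> cont\<psi> by (auto intro: borel_measurable_continuous_onI)
  have C: "0 \<le> C" using b(1)[of 0] by linarith
  have bb: "\<bar>h x * k y\<bar> \<le> C * C" if "\<And>x. \<bar>h x\<bar> \<le> C" "\<And>x. \<bar>k x\<bar> \<le> C" for h k :: "real \<Rightarrow> real" and x y
    unfolding abs_mult using that C by (intro mult_mono) auto
  have i0: "integrable std_normal_plane (\<lambda>z. l z * (h (u z) * k (v z)))"
    if h: "\<And>x. \<bar>h x\<bar> \<le> C" "\<And>x. \<bar>k x\<bar> \<le> C" and l: "integrable std_normal_plane l"
      and [measurable]: "h \<in> borel_measurable borel" "k \<in> borel_measurable borel" for h k l
  proof (rule Bochner_Integration.integrable_bound[of _ "\<lambda>z. (C * C) * l z"])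
    show "AE z in std_normal_plane. norm (l z * (h (u z) * k (v z))) \<le> norm ((C * C) * l z)"
    proof (rule AE_I2)
      fix z
      show "norm (l z * (h (u z) * k (v z))) \<le> norm ((C * C) * l z)"
        using mult_left_mono[OF bb[of h k "u z" "v z", OF h] abs_ge_zero[of "l z"]] C
        by (simp add: abs_mult mult.commute)
    qed
  qed (use l in \<open>auto simp: u_def v_def\<close>)
  have i1: "integrable std_normal_plane (\<lambda>z. fst z * (\<phi> (u z) * \<psi> (v z)))"
    "integrable std_normal_plane (\<lambda>z. snd z * (\<phi> (u z) * \<psi> (v z)))"
    using std_normal_plane_moments(1,2)[of 1] b by (auto intro!: i0)
  have i2: "integrable std_normal_plane (\<lambda>z. \<phi>' (u z) * \<psi> (v z))"
    "integrable std_normal_plane (\<lambda>z. \<phi> (u z) * \<psi>' (v z))"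
    using i0[of \<phi>' \<psi> "\<lambda>_. 1"] i0[of \<phi> \<psi>' "\<lambda>_. 1"] b by auto
  have line: "(\<integral>x. x * (\<phi> (\<alpha> * x + \<alpha>') * \<psi> (\<beta> * x + \<beta>')) \<partial>?G) =
      (\<integral>x. \<alpha> * (\<phi>' (\<alpha> * x + \<alpha>') * \<psi> (\<beta> * x + \<beta>')) + \<beta> * (\<phi> (\<alpha> * x + \<alpha>') * \<psi>' (\<beta> * x + \<beta>')) \<partial>?G)"
    for \<alpha> \<alpha>' \<beta> \<beta>'
  proof (rule std_gaussian_integration_by_parts[where C="(1 + \<bar>\<alpha>\<bar> + \<bar>\<beta>\<bar>) * (C * C)"])
    have *: "((\<lambda>x. h (k * x + l)) has_real_derivative k * h' (k * x + l)) (at x)"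
      if "\<And>x. (h has_real_derivative h' x) (at x)" for h h' :: "real \<Rightarrow> real" and k l x
    proof -
      have "((\<lambda>x. k * x + l) has_real_derivative k) (at x)"
        by (auto intro!: derivative_eq_intros)
      from DERIV_chain2[OF that this] show ?thesis by (simp add: mult.commute)
    qed
    show "((\<lambda>x. \<phi> (\<alpha> * x + \<alpha>') * \<psi> (\<beta> * x + \<beta>')) has_real_derivative
        \<alpha> * (\<phi>' (\<alpha> * x + \<alpha>') * \<psi> (\<beta> * x + \<beta>')) + \<beta> * (\<phi> (\<alpha> * x + \<alpha>') * \<psi>' (\<beta> * x + \<beta>'))) (at x)" for x
      by (rule derivative_eq_intros *[of \<phi> \<phi>', OF d\<phi>] *[of \<psi> \<psi>', OF d\<psi>])+ (simp add: algebra_simps)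
    show "continuous_on UNIV (\<lambda>x. \<alpha> * (\<phi>' (\<alpha> * x + \<alpha>') * \<psi> (\<beta> * x + \<beta>')) + \<beta> * (\<phi> (\<alpha> * x + \<alpha>') * \<psi>' (\<beta> * x + \<beta>')))"
      by (intro continuous_intros continuous_on_compose2[OF c\<phi>] continuous_on_compose2[OF c\<psi>]
          continuous_on_compose2[OF cont\<phi>] continuous_on_compose2[OF cont\<psi>]) auto
    fix x
    have "\<bar>\<phi> (\<alpha> * x + \<alpha>') * \<psi> (\<beta> * x + \<beta>')\<bar> \<le> 1 * (C * C)" using bb[of \<phi> \<psi>] b by simp
    also have "\<dots> \<le> (1 + \<bar>\<alpha>\<bar> + \<bar>\<beta>\<bar>) * (C * C)" using C by (intro mult_right_mono) auto
    finally show "\<bar>\<phi> (\<alpha> * x + \<alpha>') * \<psi> (\<beta> * x + \<beta>')\<bar> \<le> (1 + \<bar>\<alpha>\<bar> + \<bar>\<beta>\<bar>) * (C * C)" .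
    have "\<bar>\<alpha> * (\<phi>' (\<alpha> * x + \<alpha>') * \<psi> (\<beta> * x + \<beta>')) + \<beta> * (\<phi> (\<alpha> * x + \<alpha>') * \<psi>' (\<beta> * x + \<beta>'))\<bar>
        \<le> \<bar>\<alpha>\<bar> * \<bar>\<phi>' (\<alpha> * x + \<alpha>') * \<psi> (\<beta> * x + \<beta>')\<bar> + \<bar>\<beta>\<bar> * \<bar>\<phi> (\<alpha> * x + \<alpha>') * \<psi>' (\<beta> * x + \<beta>')\<bar>"
      unfolding abs_mult[symmetric] by (rule abs_triangle_ineq)
    also have "\<dots> \<le> \<bar>\<alpha>\<bar> * (C * C) + \<bar>\<beta>\<bar> * (C * C)"
      using bb[of \<phi>' \<psi>] bb[of \<phi> \<psi>'] b by (intro add_mono mult_left_mono) auto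
    also have "\<dots> \<le> (1 + \<bar>\<alpha>\<bar> + \<bar>\<beta>\<bar>) * (C * C)" using C by (simp add: algebra_simps)
    finally show "\<bar>\<alpha> * (\<phi>' (\<alpha> * x + \<alpha>') * \<psi> (\<beta> * x + \<beta>')) + \<beta> * (\<phi> (\<alpha> * x + \<alpha>') * \<psi>' (\<beta> * x + \<beta>'))\<bar>
        \<le> (1 + \<bar>\<alpha>\<bar> + \<bar>\<beta>\<bar>) * (C * C)" .
  qed
  have X: "(\<integral>z. fst z * (\<phi> (u z) * \<psi> (v z)) \<partial>std_normal_plane) =
      a * (\<integral>z. \<phi>' (u z) * \<psi> (v z) \<partial>std_normal_plane) + c * (\<integral>z. \<phi> (u z) * \<psi>' (v z) \<partial>std_normal_plane)"
  proof -
    have "(\<integral>z. fst z * (\<phi> (u z) * \<psi> (v z)) \<partial>std_normal_plane) =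
        (\<integral>y. \<integral>x. x * (\<phi> (a * x + b * y) * \<psi> (c * x + d * y)) \<partial>?G \<partial>?G)"
      using P.integral_snd[of "\<lambda>x y. x * (\<phi> (a * x + b * y) * \<psi> (c * x + d * y))"] i1(1)
      by (simp add: u_def v_def case_prod_unfold)
    also have "\<dots> = (\<integral>y. \<integral>x. a * (\<phi>' (a * x + b * y) * \<psi> (c * x + d * y))
        + c * (\<phi> (a * x + b * y) * \<psi>' (c * x + d * y)) \<partial>?G \<partial>?G)"
      by (simp add: line)
    also have "\<dots> = (\<integral>z. a * (\<phi>' (u z) * \<psi> (v z)) + c * (\<phi> (u z) * \<psi>' (v z)) \<partial>std_normal_plane)"
      using P.integral_snd[of "\<lambda>x y. a * (\<phi>' (a * x + b * y) * \<psi> (c * x + d * y))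
          + c * (\<phi> (a * x + b * y) * \<psi>' (c * x + d * y))"] i2
      by (simp add: u_def v_def case_prod_unfold)
    finally show ?thesis using i2 by simp
  qed
  have Y: "(\<integral>z. snd z * (\<phi> (u z) * \<psi> (v z)) \<partial>std_normal_plane) =
      b * (\<integral>z. \<phi>' (u z) * \<psi> (v z) \<partial>std_normal_plane) + d * (\<integral>z. \<phi> (u z) * \<psi>' (v z) \<partial>std_normal_plane)"
  proof -
    have "(\<integral>z. snd z * (\<phi> (u z) * \<psi> (v z)) \<partial>std_normal_plane) =
        (\<integral>x. \<integral>y. y * (\<phi> (b * y + a * x) * \<psi> (d * y + c * x)) \<partial>?G \<partial>?G)"
      using P.integral_fst'[OF i1(2)] by (simp add: u_def v_def add.commute)
    also have "\<dots> = (\<integral>x. \<integral>y. b * (\<phi>' (b * y + a * x) * \<psi> (d * y + c * x))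
        + d * (\<phi> (b * y + a * x) * \<psi>' (d * y + c * x)) \<partial>?G \<partial>?G)"
      by (simp add: line)
    also have "\<dots> = (\<integral>z. b * (\<phi>' (u z) * \<psi> (v z)) + d * (\<phi> (u z) * \<psi>' (v z)) \<partial>std_normal_plane)"
      using P.integral_fst'[of "\<lambda>z. b * (\<phi>' (u z) * \<psi> (v z)) + d * (\<phi> (u z) * \<psi>' (v z))"] i2
      by (simp add: u_def v_def add.commute)
    finally show ?thesis using i2 by simp
  qed
  have "(\<integral>z. (p * fst z + q * snd z) * (\<phi> (u z) * \<psi> (v z)) \<partial>std_normal_plane) =
      (\<integral>z. p * (fst z * (\<phi> (u z) * \<psi> (v z))) + q * (snd z * (\<phi> (u z) * \<psi> (v z))) \<partial>std_normal_plane)"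
    by (simp add: algebra_simps)
  also have "\<dots> = p * (\<integral>z. fst z * (\<phi> (u z) * \<psi> (v z)) \<partial>std_normal_plane)
      + q * (\<integral>z. snd z * (\<phi> (u z) * \<psi> (v z)) \<partial>std_normal_plane)"
    using i1 by simp
  also have "\<dots> = (p * a + q * b) * (\<integral>z. \<phi>' (u z) * \<psi> (v z) \<partial>std_normal_plane)
      + (p * c + q * d) * (\<integral>z. \<phi> (u z) * \<psi>' (v z) \<partial>std_normal_plane)"
    unfolding X Y by (simp add: algebra_simps)
  finally show ?thesis .
qed

definition correlated_gaussian :: "real \<Rightarrow> (real \<times> real) measure \<Rightarrow> bool" where
  "correlated_gaussian t K \<longleftrightarrow> (\<exists>a b c d. a\<^sup>2 + b\<^sup>2 = 1 \<and> c\<^sup>2 + d\<^sup>2 = 1 \<and> a * c + b * d = t \<and>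
     K = distr std_normal_plane (borel \<Otimes>\<^sub>M borel)
       (\<lambda>z. (a * fst z + b * snd z, c * fst z + d * snd z)))"

text \<open>The means of an affine image of the standard plane are its shifts, and the second
  moments are then the inner products of its coefficient rows. The five moment conditions thus
  translate directly into conditions on the coefficients.\<close>

lemma jointly_gaussian_imp_correlated_gaussian:
  assumes G: "jointly_gaussian M X Y"
    and EX: "(\<integral>\<omega>. X \<omega> \<partial>M) = 0" and EY: "(\<integral>\<omega>. Y \<omega> \<partial>M) = 0"
    and VX: "(\<integral>\<omega>. (X \<omega>)\<^sup>2 \<partial>M) = 1" and VY: "(\<integral>\<omega>. (Y \<omega>)\<^sup>2 \<partial>M) = 1"
    and cov: "(\<integral>\<omega>. X \<omega> * Y \<omega> \<partial>M) = t"
  shows "correlated_gaussian t (distr M (borel \<Otimes>\<^sub>M borel) (\<lambda>\<omega>. (X \<omega>, Y \<omega>)))"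
proof -
  have [measurable]: "X \<in> borel_measurable M" "Y \<in> borel_measurable M"
    using G by (auto simp: jointly_gaussian_def)
  obtain m n a b c d where D: "distr M (borel \<Otimes>\<^sub>M borel) (\<lambda>\<omega>. (X \<omega>, Y \<omega>)) =
      distr std_normal_plane (borel \<Otimes>\<^sub>M borel) (\<lambda>(x, y). (m + a * x + b * y, n + c * x + d * y))"
    using G unfolding jointly_gaussian_def by blast
  have E: "(\<integral>\<omega>. h (X \<omega>, Y \<omega>) \<partial>M) =
      (\<integral>z. h (m + a * fst z + b * snd z, n + c * fst z + d * snd z) \<partial>std_normal_plane)"
    if [measurable]: "h \<in> borel_measurable (borel \<Otimes>\<^sub>M borel)" for h :: "real \<times> real \<Rightarrow> real"
  proof -
    have "(\<integral>\<omega>. h (X \<omega>, Y \<omega>) \<partial>M) = (\<integral>z. h z \<partial>distr M (borel \<Otimes>\<^sub>M borel) (\<lambda>\<omega>. (X \<omega>, Y \<omega>)))"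
      by (subst integral_distr) auto
    also have "\<dots> = (\<integral>z. h (m + a * fst z + b * snd z, n + c * fst z + d * snd z) \<partial>std_normal_plane)"
      unfolding D by (subst integral_distr) (auto simp: case_prod_beta)
    finally show ?thesis .
  qed
  have m: "m = 0" using E[of fst] EX std_normal_plane_affine(1)[of m a b] by simp
  have n: "n = 0" using E[of snd] EY std_normal_plane_affine(1)[of n c d] by simp
  have "a * a + b * b = 1"
    using E[of "\<lambda>z. (fst z)\<^sup>2"] VX std_normal_plane_affine(2)[of a b a b] by (simp add: m power2_eq_square)
  moreover have "c * c + d * d = 1"
    using E[of "\<lambda>z. (snd z)\<^sup>2"] VY std_normal_plane_affine(2)[of c d c d] by (simp add: n power2_eq_square)
  moreover have "a * c + b * d = t"
    using E[of "\<lambda>z. fst z * snd z"] cov std_normal_plane_affine(2)[of a b c d] by (simp add: m n)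
  ultimately show ?thesis
    unfolding correlated_gaussian_def D m n power2_eq_square
    by - (rule exI[of _ a], rule exI[of _ b], rule exI[of _ c], rule exI[of _ d],
        simp add: case_prod_unfold)
qed

lemma correlated_gaussian_swap:
  assumes "correlated_gaussian t K"
  shows "correlated_gaussian t (distr K (borel \<Otimes>\<^sub>M borel) prod.swap)"
proof -
  obtain a b c d where K: "a\<^sup>2 + b\<^sup>2 = 1" "c\<^sup>2 + d\<^sup>2 = 1" "a * c + b * d = t"
    "K = distr std_normal_plane (borel \<Otimes>\<^sub>M borel)
       (\<lambda>z. (a * fst z + b * snd z, c * fst z + d * snd z))"
    using assms unfolding correlated_gaussian_def by blast
  have "distr K (borel \<Otimes>\<^sub>M borel) prod.swap = distr std_normal_plane (borel \<Otimes>\<^sub>M borel)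
      (\<lambda>z. (c * fst z + d * snd z, a * fst z + b * snd z))"
    unfolding K(4) prod.swap_def by (subst distr_distr) (auto simp: comp_def)
  with K(1-3) show ?thesis
    unfolding correlated_gaussian_def
    by - (rule exI[of _ c], rule exI[of _ d], rule exI[of _ a], rule exI[of _ b],
        simp add: mult.commute)
qed

text \<open>The weight \<open>x - t y\<close> is the part of \<open>x\<close> uncorrelated with \<open>y\<close>, hence no \<open>\<psi>'\<close>.\<close>

lemma correlated_gaussian_integration_by_parts:
  fixes \<phi> \<phi>' \<psi> \<psi>' :: "real \<Rightarrow> real"
  assumes K: "correlated_gaussian t K"
    and d\<phi>: "\<And>x. (\<phi> has_real_derivative \<phi>' x) (at x)" and c\<phi>: "continuous_on UNIV \<phi>'"
    and d\<psi>: "\<And>x. (\<psi> has_real_derivative \<psi>' x) (at x)" and c\<psi>: "continuous_on UNIV \<psi>'"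
    and b: "\<And>x. \<bar>\<phi> x\<bar> \<le> C" "\<And>x. \<bar>\<phi>' x\<bar> \<le> C" "\<And>x. \<bar>\<psi> x\<bar> \<le> C" "\<And>x. \<bar>\<psi>' x\<bar> \<le> C"
  shows "(\<integral>z. (fst z - t * snd z) * (\<phi> (fst z) * \<psi> (snd z)) - (1 - t\<^sup>2) * (\<phi>' (fst z) * \<psi> (snd z)) \<partial>K) = 0"
proof -
  interpret P: pair_prob_space std_normal_distribution std_normal_distribution
    by (rule pair_prob_space_std_normal)
  obtain a b c d where abcd: "a\<^sup>2 + b\<^sup>2 = 1" "c\<^sup>2 + d\<^sup>2 = 1" "a * c + b * d = t"
    "K = distr std_normal_plane (borel \<Otimes>\<^sub>M borel)
       (\<lambda>z. (a * fst z + b * snd z, c * fst z + d * snd z))"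
    using K unfolding correlated_gaussian_def by blast
  have cont\<phi>: "continuous_on UNIV \<phi>" and cont\<psi>: "continuous_on UNIV \<psi>"
    using d\<phi> d\<psi> by (auto intro!: continuous_at_imp_continuous_on intro: DERIV_isCont)
  have [measurable]: "\<phi> \<in> borel_measurable borel" "\<phi>' \<in> borel_measurable borel"
    "\<psi> \<in> borel_measurable borel" "\<psi>' \<in> borel_measurable borel"
    using c\<phi> c\<psi> cont\<phi> cont\<psi> by (auto intro: borel_measurable_continuous_onI)
  let ?u = "\<lambda>z. a * fst z + b * snd z" and ?v = "\<lambda>z. c * fst z + d * snd z"
  have C: "0 \<le> C" using b(1)[of 0] by linarith
  have i: "integrable std_normal_plane (\<lambda>z. l z * (h (?u z) * \<psi> (?v z)))"
    if h: "\<And>x. \<bar>h x\<bar> \<le> C" and l: "integrable std_normal_plane l"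
      and [measurable]: "h \<in> borel_measurable borel" for h l
  proof (rule Bochner_Integration.integrable_bound[of _ "\<lambda>z. (C * C) * l z"])
    show "AE z in std_normal_plane. norm (l z * (h (?u z) * \<psi> (?v z))) \<le> norm ((C * C) * l z)"
    proof (rule AE_I2)
      fix z
      have "\<bar>h (?u z) * \<psi> (?v z)\<bar> \<le> C * C"
        unfolding abs_mult using h b C by (intro mult_mono) auto
      from mult_left_mono[OF this abs_ge_zero[of "l z"]]
      show "norm (l z * (h (?u z) * \<psi> (?v z))) \<le> norm ((C * C) * l z)"
        using C by (simp add: abs_mult mult.commute)
    qed
  qed (use l in auto)
  \<comment> \<open>The coefficient row of \<open>fst z - t * snd z\<close>. Its inner product with
    \<open>(a, b)\<close> is \<open>1 - t\<^sup>2\<close>, and with \<open>(c, d)\<close> it is 0;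
    so the two terms left after integration by parts vanish.\<close>
  let ?p = "a - t * c" and ?q = "b - t * d"
  have "(\<integral>z. (fst z - t * snd z) * (\<phi> (fst z) * \<psi> (snd z)) - (1 - t\<^sup>2) * (\<phi>' (fst z) * \<psi> (snd z)) \<partial>K)
      = (\<integral>z. (?p * fst z + ?q * snd z) * (\<phi> (?u z) * \<psi> (?v z)) - (1 - t\<^sup>2) * (\<phi>' (?u z) * \<psi> (?v z)) \<partial>std_normal_plane)"
    unfolding abcd(4) by (subst integral_distr) (auto simp: algebra_simps)
  also have "\<dots> = (\<integral>z. (?p * fst z + ?q * snd z) * (\<phi> (?u z) * \<psi> (?v z)) \<partial>std_normal_plane)
      - (1 - t\<^sup>2) * (\<integral>z. \<phi>' (?u z) * \<psi> (?v z) \<partial>std_normal_plane)"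
    using i[of \<phi> "\<lambda>z. ?p * fst z + ?q * snd z"] std_normal_plane_affine(3)[of ?p ?q]
      i[of \<phi>' "\<lambda>_. 1"] b by simp
  also have "\<dots> = (?p * a + ?q * b - (1 - t\<^sup>2)) * (\<integral>z. \<phi>' (?u z) * \<psi> (?v z) \<partial>std_normal_plane)
      + (?p * c + ?q * d) * (\<integral>z. \<phi> (?u z) * \<psi>' (?v z) \<partial>std_normal_plane)"
    by (subst std_normal_plane_integration_by_parts[OF d\<phi> c\<phi> d\<psi> c\<psi> b]) (simp add: algebra_simps)
  also have "?p * a + ?q * b - (1 - t\<^sup>2) = a\<^sup>2 + b\<^sup>2 - 1 - t * (a * c + b * d - t)"
    by (simp add: power2_eq_square algebra_simps)
  also have "?p * c + ?q * d = (a * c + b * d) - t * (c\<^sup>2 + d\<^sup>2)"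
    by (simp add: power2_eq_square algebra_simps)
  finally show ?thesis by (simp add: abcd)
qed

section \<open>Variance of the overlap\<close>

text \<open>Expands a product of two linear combinations. With \<open>y = z\<close> the Gram matrix
  of the \<open>f e\<close> becomes visibly positive semidefinite; with distinct vectors the
  identity turns double sums over sites back into averages over one replica.\<close>

lemma (in finite_measure) gram_sum_eq_integral:
  fixes f :: "'e \<Rightarrow> 'a \<Rightarrow> real"
  assumes "\<And>e. e \<in> E \<Longrightarrow> f e \<in> borel_measurable M"
    and "\<And>e x. e \<in> E \<Longrightarrow> x \<in> space M \<Longrightarrow> \<bar>f e x\<bar> \<le> C"
  shows "(\<Sum>e\<in>E. \<Sum>e'\<in>E. y e * z e' * (\<integral>x. f e x * f e' x \<partial>M)) =
    (\<integral>x. (\<Sum>e\<in>E. y e * f e x) * (\<Sum>e\<in>E. z e * f e x) \<partial>M)"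
proof -
  have i: "integrable M (\<lambda>x. y e * z e' * (f e x * f e' x))" if "e \<in> E" "e' \<in> E" for e e'
  proof (intro integrable_mult_right integrable_const_bound[where B="C * C"] AE_I2)
    fix x assume x: "x \<in> space M"
    then show "norm (f e x * f e' x) \<le> C * C"
      using assms(2)[OF that(1) x] assms(2)[OF that(2) x] by (auto simp: abs_mult intro!: mult_mono)
  qed (use assms(1) that in auto)
  have "(\<integral>x. (\<Sum>e\<in>E. y e * f e x) * (\<Sum>e\<in>E. z e * f e x) \<partial>M) =
      (\<integral>x. (\<Sum>e\<in>E. \<Sum>e'\<in>E. y e * z e' * (f e x * f e' x)) \<partial>M)"
    by (simp add: sum_product ac_simps)
  also have "\<dots> = (\<Sum>e\<in>E. \<Sum>e'\<in>E. \<integral>x. y e * z e' * (f e x * f e' x) \<partial>M)"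
    by (subst Bochner_Integration.integral_sum, use i in \<open>auto intro!: sum.cong\<close>)
  finally show ?thesis by simp
qed

lemma (in prob_space) covariance_eq_centered:
  fixes f g :: "'a \<Rightarrow> real"
  assumes [measurable]: "f \<in> borel_measurable M" "g \<in> borel_measurable M"
    and "\<And>x. x \<in> space M \<Longrightarrow> \<bar>f x\<bar> \<le> 1" "\<And>x. x \<in> space M \<Longrightarrow> \<bar>g x\<bar> \<le> 1"
  shows "(\<integral>x. (f x - expectation f) * (g x - expectation g) \<partial>M) =
    (\<integral>x. f x * g x \<partial>M) - expectation f * expectation g"
proof -
  have i: "integrable M f" "integrable M g" "integrable M (\<lambda>x. f x * g x)"
    using assms(3,4) by (auto intro!: integrable_const_bound[where B=1] simp: abs_mult mult_le_one)
  have "(\<integral>x. (f x - expectation f) * (g x - expectation g) \<partial>M) =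
      (\<integral>x. f x * g x - expectation g * f x - expectation f * g x + expectation f * expectation g \<partial>M)"
    by (simp add: algebra_simps)
  also have "\<dots> = (\<integral>x. f x * g x \<partial>M) - expectation f * expectation g"
    using i by (simp add: prob_space algebra_simps)
  finally show ?thesis .
qed

lemma (in prob_space) abs_expectation_le_1:
  fixes h :: "'a \<Rightarrow> real"
  assumes "\<And>x. x \<in> space M \<Longrightarrow> \<bar>h x\<bar> \<le> 1"
  shows "\<bar>expectation h\<bar> \<le> 1"
proof (cases "integrable M h")
  case True
  have "\<bar>expectation h\<bar> \<le> expectation (\<lambda>x. \<bar>h x\<bar>)" by (rule integral_abs_bound)
  also have "\<dots> \<le> 1"
    using True assms by (intro integral_le_const AE_I2) auto
  finally show ?thesis .
\<comment> \<open>A non-integrable function has integral 0 by convention, which also obeys the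
  bound.\<close>
qed (simp add: not_integrable_integral_eq)

text \<open>The trace of a product of two positive semidefinite matrices is nonnegative. Writing the
  second covariance matrix as the \<open>G'\<close>-average of the rank-one matrices with entries
  \<open>c' e y * c' e' y\<close> turns the sum into the average over y of the quadratic form of the
  first matrix at \<open>c' _ y\<close>, and that form is an integral of squares.\<close>

lemma covariance_product_sum_nonneg:
  fixes f :: "'e \<Rightarrow> 's \<Rightarrow> real"
  assumes "prob_space G" "prob_space G'"
    and "\<And>e. e \<in> E \<Longrightarrow> f e \<in> borel_measurable G" "\<And>e. e \<in> E \<Longrightarrow> f e \<in> borel_measurable G'"
    and "\<And>e x. e \<in> E \<Longrightarrow> x \<in> space G \<Longrightarrow> \<bar>f e x\<bar> \<le> 1" "\<And>e x. e \<in> E \<Longrightarrow> x \<in> space G' \<Longrightarrow> \<bar>f e x\<bar> \<le> 1"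
  shows "0 \<le> (\<Sum>e\<in>E. \<Sum>e'\<in>E.
    ((\<integral>x. f e x * f e' x \<partial>G) - (\<integral>x. f e x \<partial>G) * (\<integral>x. f e' x \<partial>G)) *
    ((\<integral>x. f e x * f e' x \<partial>G') - (\<integral>x. f e x \<partial>G') * (\<integral>x. f e' x \<partial>G')))"
proof -
  interpret G: prob_space G by fact
  interpret G': prob_space G' by fact
  define c where "c e x = f e x - G.expectation (f e)" for e x
  define c' where "c' e x = f e x - G'.expectation (f e)" for e x
  define A where "A e e' = (\<integral>x. c e x * c e' x \<partial>G)" for e e'
  have A: "A e e' = (\<integral>x. f e x * f e' x \<partial>G) - G.expectation (f e) * G.expectation (f e')"
    if "e \<in> E" "e' \<in> E" for e e'
    unfolding A_def c_def using assms that by (intro G.covariance_eq_centered) auto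
  have B: "(\<integral>x. c' e x * c' e' x \<partial>G') =
      (\<integral>x. f e x * f e' x \<partial>G') - G'.expectation (f e) * G'.expectation (f e')"
    if "e \<in> E" "e' \<in> E" for e e'
    unfolding c'_def using assms that by (intro G'.covariance_eq_centered) auto
  have bc: "\<bar>c e x\<bar> \<le> 2" if "e \<in> E" "x \<in> space G" for e x
    using G.abs_expectation_le_1[of "f e"] assms(5)[OF that] assms(5)[OF that(1)]
    unfolding c_def by fastforce
  have bc': "\<bar>c' e x\<bar> \<le> 2" if "e \<in> E" "x \<in> space G'" for e x
    using G'.abs_expectation_le_1[of "f e"] assms(6)[OF that] assms(6)[OF that(1)]
    unfolding c'_def by fastforce
  have mc: "c e \<in> borel_measurable G" if "e \<in> E" for e
    unfolding c_def using assms(3)[OF that] by simp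
  have mc': "c' e \<in> borel_measurable G'" if "e \<in> E" for e
    unfolding c'_def using assms(4)[OF that] by simp
  have i: "integrable G' (\<lambda>y. A e e' * (c' e y * c' e' y))" if "e \<in> E" "e' \<in> E" for e e'
  proof (intro integrable_mult_right G'.integrable_const_bound[where B="2 * 2"] AE_I2)
    fix x assume x: "x \<in> space G'"
    then show "norm (c' e x * c' e' x) \<le> 2 * 2"
      using bc'[OF that(1) x] bc'[OF that(2) x] unfolding real_norm_def abs_mult by (intro mult_mono) auto
  qed (use mc' that in auto)
  have "0 \<le> (\<integral>y. \<integral>x. (\<Sum>e\<in>E. c' e y * c e x) * (\<Sum>e\<in>E. c' e y * c e x) \<partial>G \<partial>G')"
    by (intro Bochner_Integration.integral_nonneg) simp
  also have "\<dots> = (\<integral>y. (\<Sum>e\<in>E. \<Sum>e'\<in>E. A e e' * (c' e y * c' e' y)) \<partial>G')"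
    unfolding A_def
    by (subst G.gram_sum_eq_integral[symmetric, where C=2]) (use mc bc in \<open>auto simp: ac_simps\<close>)
  also have "\<dots> = (\<Sum>e\<in>E. \<Sum>e'\<in>E. \<integral>y. A e e' * (c' e y * c' e' y) \<partial>G')"
    by (subst Bochner_Integration.integral_sum, use i in \<open>auto intro!: sum.cong\<close>)
  also have "\<dots> = (\<Sum>e\<in>E. \<Sum>e'\<in>E. A e e' * (\<integral>y. c' e y * c' e' y \<partial>G'))"
    by simp
  finally show ?thesis by (simp add: A B cong: sum.cong)
qed

text \<open>The marginal of the infinite product at index 1; this brings the variance of the overlap
  down to a variance on one pair of replicas.\<close>

lemma gibbs_average_fst_replica:
  assumes "prob_space G\<^sub>1" "prob_space G\<^sub>2" "h \<in> borel_measurable (G\<^sub>1 \<Otimes>\<^sub>M G\<^sub>2)"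
  shows "gibbs_average G\<^sub>1 G\<^sub>2 (\<lambda>s. h (s 1)) = (\<integral>z. h z \<partial>(G\<^sub>1 \<Otimes>\<^sub>M G\<^sub>2))"
proof -
  interpret G\<^sub>1: prob_space G\<^sub>1 by fact
  interpret G\<^sub>2: prob_space G\<^sub>2 by fact
  interpret P: pair_prob_space G\<^sub>1 G\<^sub>2 by unfold_locales
  have "distr (\<Pi>\<^sub>M l\<in>{1::nat..}. G\<^sub>1 \<Otimes>\<^sub>M G\<^sub>2) (G\<^sub>1 \<Otimes>\<^sub>M G\<^sub>2) (\<lambda>s. s 1) = G\<^sub>1 \<Otimes>\<^sub>M G\<^sub>2"
    using distr_PiM_component[of "{1::nat..}" "\<lambda>_. G\<^sub>1 \<Otimes>\<^sub>M G\<^sub>2" 1] P.prob_space_axioms by simp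
  then have "(\<integral>z. h z \<partial>(G\<^sub>1 \<Otimes>\<^sub>M G\<^sub>2)) = (\<integral>z. h z \<partial>distr (\<Pi>\<^sub>M l\<in>{1::nat..}. G\<^sub>1 \<Otimes>\<^sub>M G\<^sub>2) (G\<^sub>1 \<Otimes>\<^sub>M G\<^sub>2) (\<lambda>s. s 1))"
    by simp
  also have "\<dots> = (\<integral>s. h (s 1) \<partial>(\<Pi>\<^sub>M l\<in>{1::nat..}. G\<^sub>1 \<Otimes>\<^sub>M G\<^sub>2))"
    using assms(3) by (intro integral_distr) auto
  finally show ?thesis unfolding gibbs_average_def by simp
qed

text \<open>
  This is \<open>|E|\<^sup>2 \<langle>Q\<^sub>1\<^sub>1\<^sup>2 - Q\<^sub>1\<^sub>1 Q\<^sub>2\<^sub>1\<rangle>\<close>: the replicas \<open>\<sigma>\<^sup>1, \<sigma>\<^sup>2\<close> from \<open>G\<close> share one \<open>\<rho>\<^sup>1\<close> from \<open>G'\<close>.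
\<close>

definition thermal_variance :: "'e set \<Rightarrow> ('e \<Rightarrow> 's \<Rightarrow> real) \<Rightarrow> 's measure \<Rightarrow> 's measure \<Rightarrow> real" where
  "thermal_variance E f G G' = (\<Sum>e\<in>E. \<Sum>e'\<in>E.
     ((\<integral>x. f e x * f e' x \<partial>G) - (\<integral>x. f e x \<partial>G) * (\<integral>x. f e' x \<partial>G)) * (\<integral>x. f e x * f e' x \<partial>G'))"

text \<open>Let \<open>A\<close>, \<open>B\<close> be the second moments under the two measures and
  \<open>m\<close>, \<open>n\<close> the means. The variance is a sum of terms A B - m m' n n', and
  each equals (A - m m') B + (B - n n') A - (A - m m') (B - n n'). The first two products sum to the
  thermal variances, and the sum of the last one is nonnegative by
  \<open>covariance_product_sum_nonneg\<close>.\<close>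

lemma overlap_variance_le:
  fixes f :: "'e \<Rightarrow> 's \<Rightarrow> real"
  assumes "prob_space G\<^sub>1" "prob_space G\<^sub>2"
    and m1: "\<And>e. e \<in> E \<Longrightarrow> f e \<in> borel_measurable G\<^sub>1" and m2: "\<And>e. e \<in> E \<Longrightarrow> f e \<in> borel_measurable G\<^sub>2"
    and b1: "\<And>e x. e \<in> E \<Longrightarrow> x \<in> space G\<^sub>1 \<Longrightarrow> \<bar>f e x\<bar> \<le> 1" and b2: "\<And>e x. e \<in> E \<Longrightarrow> x \<in> space G\<^sub>2 \<Longrightarrow> \<bar>f e x\<bar> \<le> 1"
  shows "gibbs_average G\<^sub>1 G\<^sub>2 (\<lambda>s. (overlap E f 1 1 s - gibbs_average G\<^sub>1 G\<^sub>2 (overlap E f 1 1))\<^sup>2)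
    \<le> (1 / real (card E))\<^sup>2 * (thermal_variance E f G\<^sub>1 G\<^sub>2 + thermal_variance E f G\<^sub>2 G\<^sub>1)"
proof -
  interpret G\<^sub>1: prob_space G\<^sub>1 by fact
  interpret G\<^sub>2: prob_space G\<^sub>2 by fact
  interpret P: pair_prob_space G\<^sub>1 G\<^sub>2 by unfold_locales
  let ?P = "G\<^sub>1 \<Otimes>\<^sub>M G\<^sub>2"
  define \<kappa> where "\<kappa> = 1 / real (card E)"
  define q where "q z = \<kappa> * (\<Sum>e\<in>E. f e (fst z) * f e (snd z))" for z
  define A where "A e e' = (\<integral>x. f e x * f e' x \<partial>G\<^sub>1)" for e e'
  define B where "B e e' = (\<integral>x. f e x * f e' x \<partial>G\<^sub>2)" for e e'
  define m where "m e = (\<integral>x. f e x \<partial>G\<^sub>1)" for e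
  define n where "n e = (\<integral>x. f e x \<partial>G\<^sub>2)" for e
  have mq: "(\<lambda>z. f e (fst z)) \<in> borel_measurable ?P" "(\<lambda>z. f e (snd z)) \<in> borel_measurable ?P" if "e \<in> E" for e
    using m1[OF that] m2[OF that] by simp_all
  have [measurable]: "q \<in> borel_measurable ?P"
    unfolding q_def using mq by (intro borel_measurable_times borel_measurable_sum) auto
  have q: "overlap E f 1 1 = (\<lambda>s. q (s 1))"
    by (simp add: overlap_def q_def \<kappa>_def fun_eq_iff)
  \<comment> \<open>Only products of one and the same function of both replicas occur:
    \<open>f e\<close> for the mean of the overlap, \<open>f e * f e'\<close> for its
    square.\<close>
  have prod: "integrable ?P (\<lambda>z. h (fst z) * h (snd z))"
    "(\<integral>z. h (fst z) * h (snd z) \<partial>?P) = (\<integral>x. h x \<partial>G\<^sub>1) * (\<integral>x. h x \<partial>G\<^sub>2)"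
    if [measurable]: "h \<in> borel_measurable G\<^sub>1" "h \<in> borel_measurable G\<^sub>2"
      and b: "\<And>x. x \<in> space G\<^sub>1 \<Longrightarrow> \<bar>h x\<bar> \<le> 1" "\<And>x. x \<in> space G\<^sub>2 \<Longrightarrow> \<bar>h x\<bar> \<le> 1" for h :: "'s \<Rightarrow> real"
  proof -
    show i: "integrable ?P (\<lambda>z. h (fst z) * h (snd z))"
      using b by (intro P.integrable_const_bound[where B=1] AE_I2)
        (auto simp: abs_mult space_pair_measure intro!: mult_le_one)
    show "(\<integral>z. h (fst z) * h (snd z) \<partial>?P) = (\<integral>x. h x \<partial>G\<^sub>1) * (\<integral>x. h x \<partial>G\<^sub>2)"
      using P.integral_fst'[OF i] by simp
  qed
  have p1: "integrable ?P (\<lambda>z. f e (fst z) * f e (snd z))"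
    "(\<integral>z. f e (fst z) * f e (snd z) \<partial>?P) = m e * n e" if "e \<in> E" for e
    using prod[of "f e"] m1 m2 b1 b2 that by (auto simp: m_def n_def)
  have p2: "integrable ?P (\<lambda>z. (f e (fst z) * f e' (fst z)) * (f e (snd z) * f e' (snd z)))"
    "(\<integral>z. (f e (fst z) * f e' (fst z)) * (f e (snd z) * f e' (snd z)) \<partial>?P) = A e e' * B e e'"
    if "e \<in> E" "e' \<in> E" for e e'
    using prod[of "\<lambda>x. f e x * f e' x"] m1 m2 b1 b2 that
    by (auto simp: A_def B_def abs_mult mult_le_one)
  have q1: "integrable ?P q" "(\<integral>z. q z \<partial>?P) = \<kappa> * (\<Sum>e\<in>E. m e * n e)"
    unfolding q_def using p1 by (auto simp: Bochner_Integration.integral_sum)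
  have sq: "(q z)\<^sup>2 = \<kappa>\<^sup>2 * (\<Sum>e\<in>E. \<Sum>e'\<in>E. (f e (fst z) * f e' (fst z)) * (f e (snd z) * f e' (snd z)))" for z
    unfolding q_def power_mult_distrib power2_eq_square[of "sum _ _"] sum_product by (simp add: ac_simps)
  have q2: "integrable ?P (\<lambda>z. (q z)\<^sup>2)" "(\<integral>z. (q z)\<^sup>2 \<partial>?P) = \<kappa>\<^sup>2 * (\<Sum>e\<in>E. \<Sum>e'\<in>E. A e e' * B e e')"
  proof -
    show "integrable ?P (\<lambda>z. (q z)\<^sup>2)" unfolding sq using p2(1) by simp
    have "(\<integral>z. (\<Sum>e\<in>E. \<Sum>e'\<in>E. (f e (fst z) * f e' (fst z)) * (f e (snd z) * f e' (snd z))) \<partial>?P)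
        = (\<Sum>e\<in>E. \<Sum>e'\<in>E. A e e' * B e e')"
      by (subst Bochner_Integration.integral_sum, use p2 in \<open>auto intro!: sum.cong\<close>)
    then show "(\<integral>z. (q z)\<^sup>2 \<partial>?P) = \<kappa>\<^sup>2 * (\<Sum>e\<in>E. \<Sum>e'\<in>E. A e e' * B e e')"
      unfolding sq by simp
  qed
  have "gibbs_average G\<^sub>1 G\<^sub>2 (\<lambda>s. (overlap E f 1 1 s - gibbs_average G\<^sub>1 G\<^sub>2 (overlap E f 1 1))\<^sup>2)
      = (\<integral>z. (q z - P.expectation q)\<^sup>2 \<partial>?P)"
    unfolding q using gibbs_average_fst_replica[OF assms(1,2), of q]
      gibbs_average_fst_replica[OF assms(1,2), of "\<lambda>z. (q z - P.expectation q)\<^sup>2"] by simp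
  also have "\<dots> = (\<integral>z. (q z)\<^sup>2 \<partial>?P) - (P.expectation q)\<^sup>2"
    using q1 q2 by (intro P.variance_eq) auto
  also have "\<dots> = \<kappa>\<^sup>2 * ((\<Sum>e\<in>E. \<Sum>e'\<in>E. A e e' * B e e') - (\<Sum>e\<in>E. m e * n e)\<^sup>2)"
    unfolding q1 q2 by (simp add: power_mult_distrib right_diff_distrib)
  also have "\<dots> \<le> \<kappa>\<^sup>2 * (thermal_variance E f G\<^sub>1 G\<^sub>2 + thermal_variance E f G\<^sub>2 G\<^sub>1)"
  proof (rule mult_left_mono)
    have "0 \<le> (\<Sum>e\<in>E. \<Sum>e'\<in>E. (A e e' - m e * m e') * (B e e' - n e * n e'))"
      unfolding A_def B_def m_def n_def using assms by (intro covariance_product_sum_nonneg) auto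
    also have "\<dots> = thermal_variance E f G\<^sub>1 G\<^sub>2 + thermal_variance E f G\<^sub>2 G\<^sub>1
        - ((\<Sum>e\<in>E. \<Sum>e'\<in>E. A e e' * B e e') - (\<Sum>e\<in>E. m e * n e)\<^sup>2)"
      unfolding thermal_variance_def A_def[symmetric] B_def[symmetric] m_def[symmetric] n_def[symmetric]
        power2_eq_square sum_product sum.distrib[symmetric] sum_subtractf[symmetric]
      by (intro sum.cong) (auto simp: algebra_simps)
    finally show "(\<Sum>e\<in>E. \<Sum>e'\<in>E. A e e' * B e e') - (\<Sum>e\<in>E. m e * n e)\<^sup>2
        \<le> thermal_variance E f G\<^sub>1 G\<^sub>2 + thermal_variance E f G\<^sub>2 G\<^sub>1" by simp
  qed simp
  finally show ?thesis unfolding \<kappa>_def .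
qed

section \<open>Gibbs measures\<close>

text \<open>One Gibbs measure with its base measure and functions frozen. The couplings
  \<open>u\<close> remain a free argument, so that averages can be differentiated in a single
  coupling.\<close>

locale gibbs_model = finite_measure \<mu> for \<mu> :: "'s measure" +
  fixes E :: "'e set" and F :: "'e \<Rightarrow> 's \<Rightarrow> real" and \<gamma> :: real
  assumes finite_E: "finite E"
    and nonzero: "emeasure \<mu> (space \<mu>) \<noteq> 0"
    and F_measurable[measurable]: "e \<in> E \<Longrightarrow> F e \<in> borel_measurable \<mu>"
    and F_bound: "e \<in> E \<Longrightarrow> \<sigma> \<in> space \<mu> \<Longrightarrow> \<bar>F e \<sigma>\<bar> \<le> 1"
begin

abbreviation G :: "('e \<Rightarrow> real) \<Rightarrow> 's measure" where
  "G u \<equiv> gibbs_measure \<gamma> (hamiltonian E u F) \<mu>"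

abbreviation weight :: "('e \<Rightarrow> real) \<Rightarrow> 's \<Rightarrow> real" where
  "weight u \<sigma> \<equiv> exp (\<gamma> * hamiltonian E u F \<sigma>)"

lemma hamiltonian_measurable[measurable]: "hamiltonian E u F \<in> borel_measurable \<mu>"
  unfolding hamiltonian_def[abs_def] by measurable

text \<open>Two choices of \<open>E'\<close> are used: the whole of \<open>E\<close> bounds the
  weight, and \<open>E - {e}\<close> bounds what stays constant when the coupling at
  \<open>e\<close> varies.\<close>

lemma abs_hamiltonian_le:
  assumes "\<sigma> \<in> space \<mu>" "E' \<subseteq> E"
  shows "\<bar>\<gamma> * (\<Sum>e\<in>E'. u e * F e \<sigma>)\<bar> \<le> \<bar>\<gamma>\<bar> * (\<Sum>e\<in>E'. \<bar>u e\<bar>)"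
proof -
  have "\<bar>\<Sum>e\<in>E'. u e * F e \<sigma>\<bar> \<le> (\<Sum>e\<in>E'. \<bar>u e * F e \<sigma>\<bar>)" by (rule sum_abs)
  also have "\<dots> \<le> (\<Sum>e\<in>E'. \<bar>u e\<bar>)"
    using F_bound assms by (intro sum_mono) (auto simp: abs_mult intro!: mult_left_le)
  finally show ?thesis by (auto simp: abs_mult intro!: mult_left_mono)
qed

lemma integrable_weight:
  assumes [measurable]: "h \<in> borel_measurable \<mu>" and h: "\<And>\<sigma>. \<sigma> \<in> space \<mu> \<Longrightarrow> \<bar>h \<sigma>\<bar> \<le> B"
  shows "integrable \<mu> (\<lambda>\<sigma>. h \<sigma> * weight u \<sigma>)"
proof (rule integrable_const_bound[where B="B * exp (\<bar>\<gamma>\<bar> * (\<Sum>e\<in>E. \<bar>u e\<bar>))"])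
  show "AE \<sigma> in \<mu>. norm (h \<sigma> * weight u \<sigma>) \<le> B * exp (\<bar>\<gamma>\<bar> * (\<Sum>e\<in>E. \<bar>u e\<bar>))"
  proof (rule AE_I2)
    fix \<sigma> assume s: "\<sigma> \<in> space \<mu>"
    show "norm (h \<sigma> * weight u \<sigma>) \<le> B * exp (\<bar>\<gamma>\<bar> * (\<Sum>e\<in>E. \<bar>u e\<bar>))"
      using h[OF s] abs_le_D1[OF abs_hamiltonian_le[OF s order_refl, of u]]
      unfolding real_norm_def abs_mult hamiltonian_def by (intro mult_mono) auto
  qed
qed simp

lemma partition_function_pos: "0 < partition_function \<gamma> (hamiltonian E u F) \<mu>"
proof -
  have i: "integrable \<mu> (weight u)" using integrable_weight[of "\<lambda>_. 1" 1 u] by simp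
  \<comment> \<open>On a nonzero measure, an everywhere positive function cannot vanish almost
    everywhere.\<close>
  have "\<not> (AE \<sigma> in \<mu>. weight u \<sigma> = 0)"
    using trivial_limit_def[of "ae_filter \<mu>"] ae_filter_eq_bot_iff[of \<mu>] nonzero by auto
  moreover have "0 \<le> (\<integral>\<sigma>. weight u \<sigma> \<partial>\<mu>)" by (intro Bochner_Integration.integral_nonneg) simp
  ultimately show ?thesis
    unfolding partition_function_def using integral_nonneg_eq_0_iff_AE[OF i] by (simp add: less_le)
qed

lemma sets_G[simp, measurable_cong]: "sets (G u) = sets \<mu>"
  by (simp add: gibbs_measure_def)

lemma space_G[simp]: "space (G u) = space \<mu>"
  by (simp add: gibbs_measure_def)

lemma integral_G:
  assumes [measurable]: "h \<in> borel_measurable \<mu>"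
  shows "(\<integral>\<sigma>. h \<sigma> \<partial>G u) = (\<integral>\<sigma>. h \<sigma> * weight u \<sigma> \<partial>\<mu>) / (\<integral>\<sigma>. weight u \<sigma> \<partial>\<mu>)"
proof -
  let ?Z = "partition_function \<gamma> (hamiltonian E u F) \<mu>"
  have "(\<integral>\<sigma>. h \<sigma> \<partial>G u) = (\<integral>\<sigma>. (weight u \<sigma> / ?Z) * h \<sigma> \<partial>\<mu>)"
    unfolding gibbs_measure_def using partition_function_pos[of u]
    by (subst integral_density) (auto intro!: divide_nonneg_pos)
  also have "\<dots> = (\<integral>\<sigma>. h \<sigma> * weight u \<sigma> / ?Z \<partial>\<mu>)" by (simp add: mult.commute)
  finally show ?thesis by (simp add: partition_function_def)
qed

lemma prob_space_G: "prob_space (G u)"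
proof (rule prob_spaceI)
  let ?Z = "partition_function \<gamma> (hamiltonian E u F) \<mu>"
  have i: "integrable \<mu> (\<lambda>\<sigma>. weight u \<sigma> / ?Z)" using integrable_weight[of "\<lambda>_. 1" 1 u] by simp
  have "emeasure (G u) (space (G u)) = (\<integral>\<^sup>+\<sigma>. ennreal (weight u \<sigma> / ?Z) \<partial>\<mu>)"
    unfolding gibbs_measure_def by (subst emeasure_density) (auto intro!: nn_integral_cong)
  also have "\<dots> = ennreal (\<integral>\<sigma>. weight u \<sigma> / ?Z \<partial>\<mu>)"
    using i partition_function_pos[of u] by (intro nn_integral_eq_integral) (auto intro!: divide_nonneg_pos)
  also have "\<dots> = 1" using partition_function_pos[of u] by (simp add: partition_function_def)
  finally show "emeasure (G u) (space (G u)) = 1" .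
qed

lemma abs_integral_G_le_1:
  assumes "\<And>\<sigma>. \<sigma> \<in> space \<mu> \<Longrightarrow> \<bar>h \<sigma>\<bar> \<le> 1"
  shows "\<bar>\<integral>\<sigma>. h \<sigma> \<partial>G u\<bar> \<le> (1::real)"
  using prob_space.abs_expectation_le_1[OF prob_space_G] assms by simp

text \<open>An average is the quotient of \<open>N h\<close> by \<open>N 1\<close>, and
  differentiating either inserts the factor \<open>\<gamma> * F e\<close>. The quotient rule then
  leaves \<gamma> times the covariance of \<open>h\<close> and \<open>F e\<close> under the Gibbs
  measure.\<close>

lemma has_real_derivative_integral_G:
  assumes e: "e \<in> E" and [measurable]: "h \<in> borel_measurable \<mu>"
    and h: "\<And>\<sigma>. \<sigma> \<in> space \<mu> \<Longrightarrow> \<bar>h \<sigma>\<bar> \<le> 1"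
  shows "((\<lambda>x. \<integral>\<sigma>. h \<sigma> \<partial>G (u(e := x))) has_real_derivative
    \<gamma> * ((\<integral>\<sigma>. h \<sigma> * F e \<sigma> \<partial>G (u(e := x))) -
         (\<integral>\<sigma>. h \<sigma> \<partial>G (u(e := x))) * (\<integral>\<sigma>. F e \<sigma> \<partial>G (u(e := x))))) (at x)"
proof -
  note [measurable] = F_measurable[OF e]
  define N where "N h x = (\<integral>\<sigma>. h \<sigma> * weight (u(e := x)) \<sigma> \<partial>\<mu>)" for h x
  let ?c = "\<lambda>\<sigma>. \<gamma> * (\<Sum>e'\<in>E - {e}. u e' * F e' \<sigma>)"
  \<comment> \<open>Separates the moving coupling from the rest of the exponent, giving the shape
    required for differentiation under the integral.\<close>
  have w: "weight (u(e := x)) \<sigma> = exp (x * (\<gamma> * F e \<sigma>) + ?c \<sigma>)" for x \<sigma>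
  proof -
    have "hamiltonian E (u(e := x)) F \<sigma> = x * F e \<sigma> + (\<Sum>e'\<in>E - {e}. u e' * F e' \<sigma>)"
      unfolding hamiltonian_def using finite_E e by (subst sum.remove[of _ e]) (auto intro!: sum.cong)
    then show ?thesis by (simp add: algebra_simps)
  qed
  have dN: "(N h has_real_derivative \<gamma> * N (\<lambda>\<sigma>. h \<sigma> * F e \<sigma>) x) (at x)"
    if [measurable]: "h \<in> borel_measurable \<mu>" and h: "\<And>\<sigma>. \<sigma> \<in> space \<mu> \<Longrightarrow> \<bar>h \<sigma>\<bar> \<le> 1" for h
  proof -
    have "(N h has_real_derivative (\<integral>\<sigma>. h \<sigma> * (\<gamma> * F e \<sigma>) * exp (x * (\<gamma> * F e \<sigma>) + ?c \<sigma>) \<partial>\<mu>)) (at x)"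
      unfolding N_def w
    proof (rule has_real_derivative_integral_exp)
      show "finite_measure \<mu>" by unfold_locales
      show "\<bar>\<gamma> * F e \<sigma>\<bar> \<le> \<bar>\<gamma>\<bar>" if "\<sigma> \<in> space \<mu>" for \<sigma>
        using F_bound[OF e that] by (auto simp: abs_mult intro!: mult_left_le)
      show "\<bar>?c \<sigma>\<bar> \<le> \<bar>\<gamma>\<bar> * (\<Sum>e\<in>E - {e}. \<bar>u e\<bar>)" if "\<sigma> \<in> space \<mu>" for \<sigma>
        by (rule abs_hamiltonian_le[OF that]) auto
    qed (use h in auto)
    moreover have "(\<integral>\<sigma>. h \<sigma> * (\<gamma> * F e \<sigma>) * exp (x * (\<gamma> * F e \<sigma>) + ?c \<sigma>) \<partial>\<mu>) = \<gamma> * N (\<lambda>\<sigma>. h \<sigma> * F e \<sigma>) x"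
      unfolding N_def w by (simp add: ac_simps flip: integral_mult_right_zero)
    ultimately show ?thesis by simp
  qed
  have G: "(\<integral>\<sigma>. h \<sigma> \<partial>G (u(e := x))) = N h x / N (\<lambda>_. 1) x" if "h \<in> borel_measurable \<mu>" for h x
    using integral_G[OF that, of "u(e := x)"] by (simp add: N_def)
  have pos: "0 < N (\<lambda>_. 1) x"
    using partition_function_pos[of "u(e := x)"] by (simp add: N_def partition_function_def)
  have "((\<lambda>x. N h x / N (\<lambda>_. 1) x) has_real_derivative
      (\<gamma> * N (\<lambda>\<sigma>. h \<sigma> * F e \<sigma>) x * N (\<lambda>_. 1) x - N h x * (\<gamma> * N (\<lambda>\<sigma>. 1 * F e \<sigma>) x))
        / (N (\<lambda>_. 1) x * N (\<lambda>_. 1) x)) (at x)"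
    using pos h by (intro DERIV_divide dN) auto
  then show ?thesis
    using pos by (simp add: G field_simps)
qed

end

section \<open>Measurability of Gibbs averages in the disorder\<close>

lemma random_finite_measure_integral_measurable:
  fixes k :: "'x \<Rightarrow> 's \<Rightarrow> real"
  assumes \<mu>: "random_finite_measure R S \<mu>" and r[measurable]: "r \<in> measurable N R"
    and k[measurable]: "(\<lambda>(x, \<sigma>). k x \<sigma>) \<in> borel_measurable (N \<Otimes>\<^sub>M S)"
  shows "(\<lambda>x. \<integral>\<sigma>. k x \<sigma> \<partial>\<mu> (r x)) \<in> borel_measurable N"
proof -
  define c where "c \<omega> = emeasure (\<mu> \<omega>) (space S)" for \<omega>
  \<comment> \<open>Dividing by the total mass, which is finite and nonzero, gives a probability
    kernel and hence a measurable map into \<open>subprob_algebra S\<close>. The mass itself is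
    measurable and is multiplied back at the end.\<close>
  define \<nu> where "\<nu> \<omega> = density (\<mu> \<omega>) (\<lambda>_. 1 / c \<omega>)" for \<omega>
  have sets_\<mu>[simp]: "sets (\<mu> \<omega>) = sets S" and c0: "c \<omega> \<noteq> 0" and cfin: "c \<omega> \<noteq> \<infinity>"
    if "\<omega> \<in> space R" for \<omega>
    using \<mu> that sets_eq_imp_space_eq[of "\<mu> \<omega>" S] finite_measure.emeasure_finite[of "\<mu> \<omega>" "space S"]
    by (auto simp: random_finite_measure_def c_def)
  have em[measurable]: "(\<lambda>\<omega>. emeasure (\<mu> \<omega>) A) \<in> borel_measurable R" if "A \<in> sets S" for A
    using \<mu> that by (auto simp: random_finite_measure_def)
  have [measurable]: "c \<in> borel_measurable R"
    unfolding c_def by measurable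
  have \<nu>[measurable]: "\<nu> \<in> measurable R (subprob_algebra S)"
  proof (rule measurable_subprob_algebra)
    fix \<omega> assume w: "\<omega> \<in> space R"
    show s: "sets (\<nu> \<omega>) = sets S" by (simp add: \<nu>_def w)
    have "space S \<in> sets (\<mu> \<omega>)" using w by simp
    then have "emeasure (\<nu> \<omega>) (space (\<nu> \<omega>)) = 1"
      using c0[OF w] cfin[OF w] sets_eq_imp_space_eq[OF s]
      by (simp add: \<nu>_def emeasure_density_const c_def[symmetric] ennreal_divide_times
          ennreal_divide_self top.not_eq_extremum)
    then show "subprob_space (\<nu> \<omega>)" by (intro prob_space_imp_subprob_space prob_spaceI)
  next
    fix A assume A[measurable]: "A \<in> sets S"
    have "(\<lambda>\<omega>. 1 / c \<omega> * emeasure (\<mu> \<omega>) A) \<in> borel_measurable R" by measurable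
    then show "(\<lambda>\<omega>. emeasure (\<nu> \<omega>) A) \<in> borel_measurable R"
      by (rule subst[OF measurable_cong, rotated]) (simp add: \<nu>_def emeasure_density_const A)
  qed
  have sets_\<nu>: "sets (\<nu> \<omega>) = sets S" if "\<omega> \<in> space R" for \<omega>
    using that by (simp add: \<nu>_def)
  have eq: "(\<integral>\<sigma>. k x \<sigma> \<partial>\<mu> (r x)) =
      enn2real (c (r x)) * (\<integral>z. (\<lambda>(x, \<sigma>). k x \<sigma>) z \<partial>distr (\<nu> (r x)) (N \<Otimes>\<^sub>M S) (Pair x))"
    if x: "x \<in> space N" for x
  proof -
    let ?\<omega> = "r x"
    have w: "?\<omega> \<in> space R" using r x by (rule measurable_space)
    have kx: "k x \<in> borel_measurable S"
      using measurable_Pair2[OF k x] by simp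
    have m: "k x \<in> borel_measurable (\<mu> ?\<omega>)"
      using kx measurable_cong_sets[OF sets_\<mu>[OF w] refl] by blast
    have p: "Pair x \<in> measurable (\<nu> ?\<omega>) (N \<Otimes>\<^sub>M S)"
      using measurable_Pair1'[OF x, of S] measurable_cong_sets[OF sets_\<nu>[OF w] refl] by blast
    have pos: "0 < enn2real (c ?\<omega>)"
      using c0[OF w] cfin[OF w] by (simp add: enn2real_positive_iff zero_less_iff_neq_zero top.not_eq_extremum)
    have inv: "1 / c ?\<omega> = ennreal (1 / enn2real (c ?\<omega>))"
      using c0[OF w] cfin[OF w] pos
      by (metis divide_ennreal ennreal_1 ennreal_enn2real infinity_ennreal_def top.not_eq_extremum zero_le_one)
    have "(\<integral>z. (\<lambda>(x, \<sigma>). k x \<sigma>) z \<partial>distr (\<nu> ?\<omega>) (N \<Otimes>\<^sub>M S) (Pair x)) = (\<integral>\<sigma>. k x \<sigma> \<partial>\<nu> ?\<omega>)"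
      using integral_distr[OF p k] by simp
    also have "\<dots> = (\<integral>\<sigma>. (1 / enn2real (c ?\<omega>)) *\<^sub>R k x \<sigma> \<partial>\<mu> ?\<omega>)"
      unfolding \<nu>_def inv using m by (intro integral_density) auto
    also have "\<dots> = (\<integral>\<sigma>. k x \<sigma> \<partial>\<mu> ?\<omega>) / enn2real (c ?\<omega>)" by simp
    finally show ?thesis using pos by simp
  qed
  \<comment> \<open>The integrand depends on x as well; pushing the kernel forward along
    \<open>Pair x\<close> leaves a fixed integrand on the product space.\<close>
  have "(\<lambda>x. distr (\<nu> (r x)) (N \<Otimes>\<^sub>M S) (Pair x)) \<in> measurable N (subprob_algebra (N \<Otimes>\<^sub>M S))"
    by (rule measurable_distr2[where M=S]) simp_all
  from measurable_compose[OF this integral_measurable_subprob_algebra[OF k]]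
  have "(\<lambda>x. enn2real (c (r x)) * (\<integral>z. (\<lambda>(x, \<sigma>). k x \<sigma>) z \<partial>distr (\<nu> (r x)) (N \<Otimes>\<^sub>M S) (Pair x)))
      \<in> borel_measurable N"
    by measurable
  then show ?thesis
    by (rule subst[OF measurable_cong, rotated]) (simp add: eq)
qed

lemma gibbs_model_random:
  assumes \<mu>: "random_finite_measure R S \<mu>" and "finite E" and \<omega>: "\<omega> \<in> space R"
    and f: "\<And>e. e \<in> E \<Longrightarrow> (\<lambda>(\<omega>, \<sigma>). f e \<omega> \<sigma>) \<in> borel_measurable (R \<Otimes>\<^sub>M S)"
    and b: "\<And>e \<omega> \<sigma>. e \<in> E \<Longrightarrow> \<omega> \<in> space R \<Longrightarrow> \<sigma> \<in> space S \<Longrightarrow> \<bar>f e \<omega> \<sigma>\<bar> \<le> 1"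
  shows "gibbs_model (\<mu> \<omega>) E (\<lambda>e. f e \<omega>)"
proof -
  have s: "sets (\<mu> \<omega>) = sets S" using \<mu> \<omega> by (auto simp: random_finite_measure_def)
  note sp = sets_eq_imp_space_eq[OF s]
  interpret finite_measure "\<mu> \<omega>" using \<mu> \<omega> by (auto simp: random_finite_measure_def)
  show ?thesis
  proof
    show "emeasure (\<mu> \<omega>) (space (\<mu> \<omega>)) \<noteq> 0"
      using \<mu> \<omega> sp by (auto simp: random_finite_measure_def)
    show "f e \<omega> \<in> borel_measurable (\<mu> \<omega>)" if "e \<in> E" for e
      using measurable_Pair2[OF f[OF that] \<omega>] measurable_cong_sets[OF s refl] by auto
  qed (use assms sp in auto)
qed

text \<open>A Gibbs average is a quotient of two integrals against the random measure. The space
  \<open>N\<close> and the map \<open>r\<close> are kept general because two cases are needed: the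
  probability space itself, and the product of the disorder with an independent copy of the Gaussian
  field, where \<open>r\<close> is the first projection.\<close>

lemma random_gibbs_integral_measurable:
  fixes h :: "'w \<Rightarrow> 's \<Rightarrow> real"
  assumes \<mu>: "random_finite_measure R S \<mu>" and finE: "finite E" and r[measurable]: "r \<in> measurable N R"
    and f[measurable]: "\<And>e. e \<in> E \<Longrightarrow> (\<lambda>(\<omega>, \<sigma>). f e \<omega> \<sigma>) \<in> borel_measurable (R \<Otimes>\<^sub>M S)"
    and b: "\<And>e \<omega> \<sigma>. e \<in> E \<Longrightarrow> \<omega> \<in> space R \<Longrightarrow> \<sigma> \<in> space S \<Longrightarrow> \<bar>f e \<omega> \<sigma>\<bar> \<le> 1"
    and h[measurable]: "(\<lambda>(\<omega>, \<sigma>). h \<omega> \<sigma>) \<in> borel_measurable (R \<Otimes>\<^sub>M S)"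
    and u[measurable]: "\<And>e. e \<in> E \<Longrightarrow> (\<lambda>x. u x e) \<in> borel_measurable N"
  shows "(\<lambda>x. \<integral>\<sigma>. h (r x) \<sigma> \<partial>gibbs_measure \<gamma> (hamiltonian E (u x) (\<lambda>e. f e (r x))) (\<mu> (r x)))
    \<in> borel_measurable N"
proof -
  have m: "(\<lambda>(x, \<sigma>). k (r x) \<sigma>) \<in> borel_measurable (N \<Otimes>\<^sub>M S)"
    if [measurable]: "(\<lambda>(\<omega>, \<sigma>). k \<omega> \<sigma>) \<in> borel_measurable (R \<Otimes>\<^sub>M S)" for k :: "'w \<Rightarrow> 's \<Rightarrow> real"
  proof -
    have "(\<lambda>z. (r (fst z), snd z)) \<in> measurable (N \<Otimes>\<^sub>M S) (R \<Otimes>\<^sub>M S)" by measurable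
    from measurable_compose[OF this that] show ?thesis by (simp add: case_prod_beta')
  qed
  let ?w = "\<lambda>x \<sigma>. exp (\<gamma> * hamiltonian E (u x) (\<lambda>e. f e (r x)) \<sigma>)"
  note mf = m[OF f]
  have w: "(\<lambda>(x, \<sigma>). ?w x \<sigma>) \<in> borel_measurable (N \<Otimes>\<^sub>M S)"
    unfolding hamiltonian_def case_prod_beta'
    by (intro borel_measurable_exp[THEN measurable_compose[rotated]] borel_measurable_times
        borel_measurable_sum measurable_compose[OF measurable_fst u] borel_measurable_const)
      (use mf in \<open>auto simp: case_prod_beta'\<close>)
  have hw: "(\<lambda>(x, \<sigma>). h (r x) \<sigma> * ?w x \<sigma>) \<in> borel_measurable (N \<Otimes>\<^sub>M S)"
    using borel_measurable_times[OF m[OF h] w] by (simp add: case_prod_beta')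
  have "(\<lambda>x. (\<integral>\<sigma>. h (r x) \<sigma> * ?w x \<sigma> \<partial>\<mu> (r x)) / (\<integral>\<sigma>. ?w x \<sigma> \<partial>\<mu> (r x))) \<in> borel_measurable N"
    by (intro borel_measurable_divide random_finite_measure_integral_measurable[OF \<mu> r] w hw)
  moreover have "(\<integral>\<sigma>. h (r x) \<sigma> \<partial>gibbs_measure \<gamma> (hamiltonian E (u x) (\<lambda>e. f e (r x))) (\<mu> (r x))) =
      (\<integral>\<sigma>. h (r x) \<sigma> * ?w x \<sigma> \<partial>\<mu> (r x)) / (\<integral>\<sigma>. ?w x \<sigma> \<partial>\<mu> (r x))" if x: "x \<in> space N" for x
  proof -
    have rx: "r x \<in> space R" using r x by (rule measurable_space)
    interpret gibbs_model "\<mu> (r x)" E "\<lambda>e. f e (r x)" \<gamma>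
      using \<mu> finE rx f b by (rule gibbs_model_random)
    have s: "sets (\<mu> (r x)) = sets S" using \<mu> rx by (auto simp: random_finite_measure_def)
    have "h (r x) \<in> borel_measurable (\<mu> (r x))"
      using measurable_Pair2[OF h rx] measurable_cong_sets[OF s refl] by auto
    then show ?thesis by (rule integral_G)
  qed
  ultimately show ?thesis by (subst measurable_cong)
qed

section \<open>Correlated disorder\<close>

text \<open>The triples \<open>(g, \<mu>, \<gamma>)\<close> and \<open>(h, \<nu>, \<delta>)\<close>
  are two roles. The hypotheses are invariant under exchanging them, while the estimate derived here
  concerns the covariances under the first Gibbs measure only; a second instance with the roles
  exchanged supplies the other half.\<close>

locale coupled_gibbs = prob_space M for M :: "'w measure" +
  fixes R :: "'w measure" and S :: "'s measure" and E :: "'e set"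
    and f :: "'e \<Rightarrow> 'w \<Rightarrow> 's \<Rightarrow> real" and g h :: "'e \<Rightarrow> 'w \<Rightarrow> real"
    and \<mu> \<nu> :: "'w \<Rightarrow> 's measure" and \<gamma> \<delta> t :: real
  assumes finite_E: "finite E" and nonempty_E: "E \<noteq> {}"
    and subalg: "subalgebra M R"
    and f_measurable: "\<And>e. e \<in> E \<Longrightarrow> (\<lambda>(\<omega>, \<sigma>). f e \<omega> \<sigma>) \<in> borel_measurable (R \<Otimes>\<^sub>M S)"
    and f_bound: "\<And>e \<omega> \<sigma>. e \<in> E \<Longrightarrow> \<omega> \<in> space R \<Longrightarrow> \<sigma> \<in> space S \<Longrightarrow> \<bar>f e \<omega> \<sigma>\<bar> \<le> 1"
    and \<mu>: "random_finite_measure R S \<mu>" and \<nu>: "random_finite_measure R S \<nu>"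
    and g_measurable[measurable]: "\<And>e. e \<in> E \<Longrightarrow> g e \<in> borel_measurable M"
    and h_measurable[measurable]: "\<And>e. e \<in> E \<Longrightarrow> h e \<in> borel_measurable M"
    and gaussian: "\<And>e. e \<in> E \<Longrightarrow>
      correlated_gaussian t (distr M (borel \<Otimes>\<^sub>M borel) (\<lambda>\<omega>. (g e \<omega>, h e \<omega>)))"
    and g_variance: "\<And>e. e \<in> E \<Longrightarrow> (\<integral>\<omega>. (g e \<omega>)\<^sup>2 \<partial>M) = 1"
    and h_variance: "\<And>e. e \<in> E \<Longrightarrow> (\<integral>\<omega>. (h e \<omega>)\<^sup>2 \<partial>M) = 1"
    and covariance: "\<And>e. e \<in> E \<Longrightarrow> (\<integral>\<omega>. g e \<omega> * h e \<omega> \<partial>M) = t"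
    and indep_pairs: "indep_vars (\<lambda>_. borel \<Otimes>\<^sub>M borel) (\<lambda>e \<omega>. (g e \<omega>, h e \<omega>)) E"
    and indep_R: "indep_set (sets R)
      (sets (vimage_algebra (space M) (\<lambda>\<omega>. \<lambda>e\<in>E. (g e \<omega>, h e \<omega>)) (\<Pi>\<^sub>M e\<in>E. borel \<Otimes>\<^sub>M borel)))"
    and pos: "0 < \<gamma>" "0 < \<delta>" and t: "0 \<le> t" "t < 1"
begin

abbreviation Pr :: "('e \<Rightarrow> real \<times> real) measure" where
  "Pr \<equiv> \<Pi>\<^sub>M e\<in>E. borel \<Otimes>\<^sub>M borel"

definition gauss :: "'w \<Rightarrow> 'e \<Rightarrow> real \<times> real" where
  "gauss \<omega> = (\<lambda>e\<in>E. (g e \<omega>, h e \<omega>))"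

section \<open>Independence of the Gaussian field from the remaining disorder\<close>

lemma space_R: "space R = space M" and sets_R: "sets R \<subseteq> sets M"
  using subalg by (auto simp: subalgebra_def)

lemma ident_measurable[measurable]: "(\<lambda>\<omega>. \<omega>) \<in> measurable M R"
  using space_R sets_R by (intro measurableI) auto

lemma gauss_measurable[measurable]: "gauss \<in> measurable M Pr"
  unfolding gauss_def[abs_def] by (intro measurable_restrict) simp

text \<open>Only the conditions on the ordered pairs require an argument: their laws, their mutual
  independence and the \<sigma>-algebra they generate. Each is carried over by the measurable
  exchange of components.\<close>

lemma swapped: "coupled_gibbs M R S E f h g \<nu> \<mu> \<delta> \<gamma> t"
proof unfold_locales
  fix e assume e: "e \<in> E"
  note [measurable] = g_measurable[OF e] h_measurable[OF e]
  have "distr M (borel \<Otimes>\<^sub>M borel) (\<lambda>\<omega>. (h e \<omega>, g e \<omega>)) =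
      distr (distr M (borel \<Otimes>\<^sub>M borel) (\<lambda>\<omega>. (g e \<omega>, h e \<omega>))) (borel \<Otimes>\<^sub>M borel) prod.swap"
    unfolding prod.swap_def by (subst distr_distr) (auto simp: comp_def)
  then show "correlated_gaussian t (distr M (borel \<Otimes>\<^sub>M borel) (\<lambda>\<omega>. (h e \<omega>, g e \<omega>)))"
    using correlated_gaussian_swap[OF gaussian[OF e]] by simp
next
  show "indep_vars (\<lambda>_. borel \<Otimes>\<^sub>M borel) (\<lambda>e \<omega>. (h e \<omega>, g e \<omega>)) E"
    using indep_vars_compose2[OF indep_pairs, of "\<lambda>_ z. (snd z, fst z)" "\<lambda>_. borel \<Otimes>\<^sub>M borel"] by simp
next
  let ?g = "\<lambda>\<omega>. \<lambda>e\<in>E. (h e \<omega>, g e \<omega>)" and ?s = "\<lambda>p. \<lambda>e\<in>E. (snd (p e), fst (p e))"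
  have s: "?s \<in> measurable Pr Pr" by (intro measurable_restrict) simp
  have gauss_space: "gauss \<omega> \<in> space Pr" if "\<omega> \<in> space M" for \<omega>
    using measurable_space[OF gauss_measurable that] .
  \<comment> \<open>The exchanged field is a measurable function of the original one, so it
    generates no larger \<sigma>-algebra, and independence passes to smaller families.\<close>
  have "sets (vimage_algebra (space M) ?g Pr) \<subseteq> sets (vimage_algebra (space M) gauss Pr)"
  proof
    fix X assume "X \<in> sets (vimage_algebra (space M) ?g Pr)"
    moreover have "?g \<in> space M \<rightarrow> space Pr" by (auto simp: space_PiM space_pair_measure)
    ultimately obtain A where A: "A \<in> sets Pr" "X = ?g -` A \<inter> space M"
      by (auto simp: sets_vimage_algebra2)
    have "?g \<omega> = ?s (gauss \<omega>)" for \<omega> by (auto simp: gauss_def fun_eq_iff)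
    then have "X = gauss -` (?s -` A \<inter> space Pr) \<inter> space M"
      using A(2) gauss_space by auto
    then show "X \<in> sets (vimage_algebra (space M) gauss Pr)"
      using in_vimage_algebra[OF measurable_sets[OF s A(1)], of gauss "space M"] by simp
  qed
  then show "indep_set (sets R) (sets (vimage_algebra (space M) ?g Pr))"
    using indep_R unfolding indep_sets2_eq gauss_def[abs_def] by blast
qed (use finite_E nonempty_E subalg f_measurable f_bound \<mu> \<nu> g_variance h_variance covariance pos t
      in \<open>auto simp: mult.commute\<close>)

text \<open>The value \<open>(0, 0)\<close> outside \<open>E\<close> makes \<open>K e\<close> a
  point mass there, so that \<open>K\<close> is a family of probability measures over all indices,
  as \<open>product_prob_space\<close> demands.\<close>

definition K :: "'e \<Rightarrow> (real \<times> real) measure" where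
  "K e = distr M (borel \<Otimes>\<^sub>M borel) (\<lambda>\<omega>. if e \<in> E then (g e \<omega>, h e \<omega>) else (0, 0))"

lemma K_eq: "e \<in> E \<Longrightarrow> K e = distr M (borel \<Otimes>\<^sub>M borel) (\<lambda>\<omega>. (g e \<omega>, h e \<omega>))"
  by (simp add: K_def)

lemma prob_space_K: "prob_space (K e)"
  unfolding K_def by (intro prob_space_distr) (cases "e \<in> E", auto)

text \<open>
  The library's \<open>indep_var\<close> needs both variables to have the same value type, hence the direct proof.
\<close>

lemma joint_law:
  "distr M (R \<Otimes>\<^sub>M Pr) (\<lambda>\<omega>. (\<omega>, gauss \<omega>)) = distr M R (\<lambda>\<omega>. \<omega>) \<Otimes>\<^sub>M (\<Pi>\<^sub>M e\<in>E. K e)"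
proof -
  have J: "(\<lambda>\<omega>. (\<omega>, gauss \<omega>)) \<in> measurable M (R \<Otimes>\<^sub>M Pr)" by simp
  interpret R: prob_space "distr M R (\<lambda>\<omega>. \<omega>)" by (intro prob_space_distr) simp
  interpret Pr: prob_space "distr M Pr gauss" by (intro prob_space_distr) simp
  have "distr M R (\<lambda>\<omega>. \<omega>) \<Otimes>\<^sub>M distr M Pr gauss = distr M (R \<Otimes>\<^sub>M Pr) (\<lambda>\<omega>. (\<omega>, gauss \<omega>))"
  proof (rule pair_measure_eqI)
    fix A B assume "A \<in> sets (distr M R (\<lambda>\<omega>. \<omega>))" "B \<in> sets (distr M Pr gauss)"
    then have A: "A \<in> sets R" and B: "B \<in> sets Pr" by simp_all
    have B': "gauss -` B \<inter> space M \<in> sets (vimage_algebra (space M) gauss Pr)"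
      using B by (rule in_vimage_algebra)
    have "prob (A \<inter> (gauss -` B \<inter> space M)) = prob A * prob (gauss -` B \<inter> space M)"
      using indep_setD[OF indep_R[folded gauss_def[abs_def]] A B'] .
    moreover have "(\<lambda>\<omega>. (\<omega>, gauss \<omega>)) -` (A \<times> B) \<inter> space M = A \<inter> (gauss -` B \<inter> space M)" by auto
    moreover have "(\<lambda>\<omega>. \<omega>) -` A \<inter> space M = A"
      using sets.sets_into_space[OF A] space_R by auto
    ultimately show "emeasure (distr M R (\<lambda>\<omega>. \<omega>)) A * emeasure (distr M Pr gauss) B =
        emeasure (distr M (R \<Otimes>\<^sub>M Pr) (\<lambda>\<omega>. (\<omega>, gauss \<omega>))) (A \<times> B)"
      using A B by (simp add: emeasure_distr[OF J] emeasure_distr emeasure_eq_measure ennreal_mult)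
  qed (unfold_locales, simp)
  then have "distr M (R \<Otimes>\<^sub>M Pr) (\<lambda>\<omega>. (\<omega>, gauss \<omega>)) = distr M R (\<lambda>\<omega>. \<omega>) \<Otimes>\<^sub>M distr M Pr gauss"
    by simp
  also have "distr M Pr gauss = (\<Pi>\<^sub>M e\<in>E. distr M (borel \<Otimes>\<^sub>M borel) (\<lambda>\<omega>. (g e \<omega>, h e \<omega>)))"
    unfolding gauss_def[abs_def]
    using indep_vars_iff_distr_eq_PiM'[where I=E and M'="\<lambda>_. borel \<Otimes>\<^sub>M borel" and X="\<lambda>e \<omega>. (g e \<omega>, h e \<omega>)"]
      nonempty_E indep_pairs by simp
  also have "\<dots> = (\<Pi>\<^sub>M e\<in>E. K e)"
    by (intro PiM_cong) (simp_all add: K_eq)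
  finally show ?thesis .
qed

text \<open>A section that is not integrable contributes \<open>0\<close> by the convention for Bochner integrals, so
  the hypothesis on the sections needs no integrability.\<close>

lemma integral_eq_0_by_resampling:
  fixes \<Phi> :: "'w \<times> ('e \<Rightarrow> real \<times> real) \<Rightarrow> real"
  assumes [measurable]: "\<Phi> \<in> borel_measurable (R \<Otimes>\<^sub>M Pr)"
    and i: "integrable M (\<lambda>\<omega>. \<Phi> (\<omega>, gauss \<omega>))" and e: "e \<in> E"
    and zero: "\<And>\<omega> p. \<omega> \<in> space R \<Longrightarrow> (\<integral>y. \<Phi> (\<omega>, p(e := y)) \<partial>K e) = 0"
  shows "(\<integral>\<omega>. \<Phi> (\<omega>, gauss \<omega>) \<partial>M) = 0"
proof -
  let ?R = "distr M R (\<lambda>\<omega>. \<omega>)" and ?P = "\<Pi>\<^sub>M e\<in>E. K e"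
  interpret R: prob_space ?R by (intro prob_space_distr) simp
  interpret K: product_prob_space K E
    using prob_space_K by (intro product_prob_spaceI)
  interpret P: pair_prob_space ?R ?P by unfold_locales
  have J: "(\<lambda>\<omega>. (\<omega>, gauss \<omega>)) \<in> measurable M (R \<Otimes>\<^sub>M Pr)" by simp
  have i': "integrable (?R \<Otimes>\<^sub>M ?P) \<Phi>"
    unfolding joint_law[symmetric] using i by (subst integrable_distr_eq[OF J]) auto
  have "(\<integral>\<omega>. \<Phi> (\<omega>, gauss \<omega>) \<partial>M) = (\<integral>z. \<Phi> z \<partial>(?R \<Otimes>\<^sub>M ?P))"
    unfolding joint_law[symmetric] by (subst integral_distr[OF J]) auto
  also have "\<dots> = (\<integral>\<omega>. \<integral>p. \<Phi> (\<omega>, p) \<partial>?P \<partial>?R)"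
    using P.integral_fst'[OF i'] by simp
  also have "\<dots> = (\<integral>\<omega>. 0 \<partial>?R)"
  proof (intro Bochner_Integration.integral_cong refl)
    fix \<omega> assume w: "\<omega> \<in> space ?R"
    show "(\<integral>p. \<Phi> (\<omega>, p) \<partial>?P) = 0"
    proof (cases "integrable ?P (\<lambda>p. \<Phi> (\<omega>, p))")
      case True
      \<comment> \<open>Splits coordinate \<open>e\<close> off the product of laws, so that it is
        integrated first, with the other coordinates frozen.\<close>
      have E: "E = insert e (E - {e})" using e by auto
      have "(\<integral>p. \<Phi> (\<omega>, p) \<partial>?P) = (\<integral>p. \<integral>y. \<Phi> (\<omega>, p(e := y)) \<partial>K e \<partial>(\<Pi>\<^sub>M e\<in>E - {e}. K e))"
        using K.product_integral_insert[of "E - {e}" e "\<lambda>p. \<Phi> (\<omega>, p)"] True finite_E E by simp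
      then show ?thesis using zero w by simp
    qed (simp add: not_integrable_integral_eq)
  qed
  finally show ?thesis by simp
qed

section \<open>Gibbs averages as functions of the couplings\<close>

definition observable :: "('w \<Rightarrow> 's \<Rightarrow> real) \<Rightarrow> bool" where
  "observable k \<longleftrightarrow> (\<lambda>(\<omega>, \<sigma>). k \<omega> \<sigma>) \<in> borel_measurable (R \<Otimes>\<^sub>M S) \<and>
     (\<forall>\<omega>\<in>space R. \<forall>\<sigma>\<in>space S. \<bar>k \<omega> \<sigma>\<bar> \<le> 1)"

lemma observable_1: "observable (\<lambda>_ _. 1)"
  by (simp add: observable_def case_prod_beta')

lemma observable_f: "e \<in> E \<Longrightarrow> observable (f e)"
  using f_measurable f_bound by (simp add: observable_def)

text \<open>Closure under products keeps derivatives inside the class: differentiating the average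
  of \<open>k\<close> produces averages of \<open>k * f e\<close>, \<open>k\<close> and
  \<open>f e\<close>, all bounded by 1.\<close>

lemma observable_mult: "observable k \<Longrightarrow> observable l \<Longrightarrow> observable (\<lambda>\<omega> \<sigma>. k \<omega> \<sigma> * l \<omega> \<sigma>)"
  by (auto simp: observable_def case_prod_beta' abs_mult intro!: borel_measurable_times mult_le_one)

abbreviation G\<^sub>1 :: "'w \<Rightarrow> ('e \<Rightarrow> real) \<Rightarrow> 's measure" where
  "G\<^sub>1 \<omega> u \<equiv> gibbs_measure \<gamma> (hamiltonian E u (\<lambda>e. f e \<omega>)) (\<mu> \<omega>)"

abbreviation G\<^sub>2 :: "'w \<Rightarrow> ('e \<Rightarrow> real) \<Rightarrow> 's measure" where
  "G\<^sub>2 \<omega> u \<equiv> gibbs_measure \<delta> (hamiltonian E u (\<lambda>e. f e \<omega>)) (\<nu> \<omega>)"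

text \<open>The couplings are an argument apart from \<open>\<omega>\<close>, so one of them can be
  changed while \<open>f\<close> and the base measure keep their values at
  \<open>\<omega>\<close>.\<close>

definition avg\<^sub>1 :: "('w \<Rightarrow> 's \<Rightarrow> real) \<Rightarrow> 'w \<Rightarrow> ('e \<Rightarrow> real) \<Rightarrow> real" where
  "avg\<^sub>1 k \<omega> u = (\<integral>\<sigma>. k \<omega> \<sigma> \<partial>G\<^sub>1 \<omega> u)"

definition avg\<^sub>2 :: "('w \<Rightarrow> 's \<Rightarrow> real) \<Rightarrow> 'w \<Rightarrow> ('e \<Rightarrow> real) \<Rightarrow> real" where
  "avg\<^sub>2 k \<omega> u = (\<integral>\<sigma>. k \<omega> \<sigma> \<partial>G\<^sub>2 \<omega> u)"

text \<open>The field \<open>gauss \<omega>\<close> carries the actual couplings on \<open>E\<close>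
  only, and the Hamiltonian reads no others.\<close>

lemma avg_cong:
  assumes "\<And>e. e \<in> E \<Longrightarrow> u e = v e"
  shows "avg\<^sub>1 k \<omega> u = avg\<^sub>1 k \<omega> v" "avg\<^sub>2 k \<omega> u = avg\<^sub>2 k \<omega> v"
proof -
  have "hamiltonian E u (\<lambda>e. f e \<omega>) = hamiltonian E v (\<lambda>e. f e \<omega>)"
    unfolding hamiltonian_def using assms by (auto intro!: sum.cong)
  then show "avg\<^sub>1 k \<omega> u = avg\<^sub>1 k \<omega> v" "avg\<^sub>2 k \<omega> u = avg\<^sub>2 k \<omega> v"
    by (simp_all add: avg\<^sub>1_def avg\<^sub>2_def)
qed

lemma model_1: "\<omega> \<in> space R \<Longrightarrow> gibbs_model (\<mu> \<omega>) E (\<lambda>e. f e \<omega>)"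
  by (rule gibbs_model_random[OF \<mu> finite_E _ f_measurable f_bound])

lemma model_2: "\<omega> \<in> space R \<Longrightarrow> gibbs_model (\<nu> \<omega>) E (\<lambda>e. f e \<omega>)"
  by (rule gibbs_model_random[OF \<nu> finite_E _ f_measurable f_bound])

lemma sets_random:
  assumes "\<omega> \<in> space R"
  shows "sets (\<mu> \<omega>) = sets S" "sets (\<nu> \<omega>) = sets S" "space (\<mu> \<omega>) = space S" "space (\<nu> \<omega>) = space S"
proof -
  show s: "sets (\<mu> \<omega>) = sets S" "sets (\<nu> \<omega>) = sets S"
    using assms \<mu> \<nu> by (auto simp: random_finite_measure_def)
  show "space (\<mu> \<omega>) = space S" "space (\<nu> \<omega>) = space S"
    using sets_eq_imp_space_eq[OF s(1)] sets_eq_imp_space_eq[OF s(2)] .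
qed

lemma observable_section:
  assumes "observable k" and w: "\<omega> \<in> space R"
  shows "k \<omega> \<in> borel_measurable (\<mu> \<omega>)" "k \<omega> \<in> borel_measurable (\<nu> \<omega>)"
    "\<And>\<sigma>. \<sigma> \<in> space (\<mu> \<omega>) \<Longrightarrow> \<bar>k \<omega> \<sigma>\<bar> \<le> 1" "\<And>\<sigma>. \<sigma> \<in> space (\<nu> \<omega>) \<Longrightarrow> \<bar>k \<omega> \<sigma>\<bar> \<le> 1"
proof -
  have "k \<omega> \<in> borel_measurable S"
    using measurable_Pair2[of "\<lambda>(\<omega>, \<sigma>). k \<omega> \<sigma>" R S borel, OF _ w] assms(1) by (simp add: observable_def)
  then show "k \<omega> \<in> borel_measurable (\<mu> \<omega>)" "k \<omega> \<in> borel_measurable (\<nu> \<omega>)"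
    using measurable_cong_sets[OF sets_random(1)[OF w] refl] measurable_cong_sets[OF sets_random(2)[OF w] refl]
    by blast+
qed (use assms sets_random[OF w] in \<open>auto simp: observable_def\<close>)

lemma avg_bound:
  assumes "observable k" "\<omega> \<in> space R"
  shows "\<bar>avg\<^sub>1 k \<omega> u\<bar> \<le> 1" "\<bar>avg\<^sub>2 k \<omega> u\<bar> \<le> 1"
  unfolding avg\<^sub>1_def avg\<^sub>2_def
  using gibbs_model.abs_integral_G_le_1[OF model_1[OF assms(2)]] observable_section(3)[OF assms]
    gibbs_model.abs_integral_G_le_1[OF model_2[OF assms(2)]] observable_section(4)[OF assms] by blast+

lemma avg_measurable:
  assumes k: "observable k" and r: "r \<in> measurable N R" and u: "\<And>e. e \<in> E \<Longrightarrow> (\<lambda>x. u x e) \<in> borel_measurable N"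
  shows "(\<lambda>x. avg\<^sub>1 k (r x) (u x)) \<in> borel_measurable N" "(\<lambda>x. avg\<^sub>2 k (r x) (u x)) \<in> borel_measurable N"
  unfolding avg\<^sub>1_def avg\<^sub>2_def
  using k f_measurable f_bound u r \<mu> \<nu> finite_E
  by (auto intro!: random_gibbs_integral_measurable simp: observable_def)

lemma avg\<^sub>1_deriv:
  assumes "observable k" "\<omega> \<in> space R" "e \<in> E"
  shows "((\<lambda>x. avg\<^sub>1 k \<omega> (u(e := x))) has_real_derivative
    \<gamma> * (avg\<^sub>1 (\<lambda>\<omega> \<sigma>. k \<omega> \<sigma> * f e \<omega> \<sigma>) \<omega> (u(e := x)) - avg\<^sub>1 k \<omega> (u(e := x)) * avg\<^sub>1 (f e) \<omega> (u(e := x)))) (at x)"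
  unfolding avg\<^sub>1_def
  by (rule gibbs_model.has_real_derivative_integral_G[OF model_1[OF assms(2)] assms(3)])
    (use observable_section[OF assms(1,2)] in auto)

lemma avg\<^sub>2_deriv:
  assumes "observable k" "\<omega> \<in> space R" "e \<in> E"
  shows "((\<lambda>x. avg\<^sub>2 k \<omega> (u(e := x))) has_real_derivative
    \<delta> * (avg\<^sub>2 (\<lambda>\<omega> \<sigma>. k \<omega> \<sigma> * f e \<omega> \<sigma>) \<omega> (u(e := x)) - avg\<^sub>2 k \<omega> (u(e := x)) * avg\<^sub>2 (f e) \<omega> (u(e := x)))) (at x)"
  unfolding avg\<^sub>2_def
  by (rule gibbs_model.has_real_derivative_integral_G[OF model_2[OF assms(2)] assms(3)])
    (use observable_section[OF assms(1,2)] in auto)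

lemma avg_continuous:
  assumes "observable k" "\<omega> \<in> space R" "e \<in> E"
  shows "continuous_on UNIV (\<lambda>x. avg\<^sub>1 k \<omega> (u(e := x)))" "continuous_on UNIV (\<lambda>x. avg\<^sub>2 k \<omega> (u(e := x)))"
  using DERIV_isCont[OF avg\<^sub>1_deriv[OF assms]] DERIV_isCont[OF avg\<^sub>2_deriv[OF assms]]
  by (simp_all add: continuous_on_eq_continuous_at)

section \<open>Integration by parts in the disorder\<close>

abbreviation w :: "'e \<Rightarrow> 'w \<Rightarrow> real" where
  "w e \<omega> \<equiv> g e \<omega> - t * h e \<omega>"

abbreviation E\<^sub>1 :: "('w \<Rightarrow> 's \<Rightarrow> real) \<Rightarrow> 'w \<Rightarrow> real" where
  "E\<^sub>1 k \<omega> \<equiv> avg\<^sub>1 k \<omega> (\<lambda>e. g e \<omega>)"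

abbreviation E\<^sub>2 :: "('w \<Rightarrow> 's \<Rightarrow> real) \<Rightarrow> 'w \<Rightarrow> real" where
  "E\<^sub>2 k \<omega> \<equiv> avg\<^sub>2 k \<omega> (\<lambda>e. h e \<omega>)"

lemma E_measurable:
  assumes "observable k"
  shows "E\<^sub>1 k \<in> borel_measurable M" "E\<^sub>2 k \<in> borel_measurable M"
  using avg_measurable[OF assms, of "\<lambda>\<omega>. \<omega>" M "\<lambda>\<omega> e. g e \<omega>"]
    avg_measurable[OF assms, of "\<lambda>\<omega>. \<omega>" M "\<lambda>\<omega> e. h e \<omega>"] by simp_all

lemma E_bound:
  assumes "observable k" "\<omega> \<in> space M"
  shows "\<bar>E\<^sub>1 k \<omega>\<bar> \<le> 1" "\<bar>E\<^sub>2 k \<omega>\<bar> \<le> 1"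
  using avg_bound assms space_R by auto

lemma integrable_mult_bounded:
  assumes "integrable M X" "Y \<in> borel_measurable M" "\<And>\<omega>. \<omega> \<in> space M \<Longrightarrow> \<bar>Y \<omega>\<bar> \<le> (1::real)"
  shows "integrable M (\<lambda>\<omega>. X \<omega> * Y \<omega>)"
proof (rule Bochner_Integration.integrable_bound[OF assms(1)])
  show "AE \<omega> in M. norm (X \<omega> * Y \<omega>) \<le> norm (X \<omega>)"
    using assms(3) by (intro AE_I2) (auto simp: abs_mult intro: mult_left_le)
qed (use assms in auto)

lemma square_integrable:
  assumes e: "e \<in> E"
  shows "integrable M (\<lambda>\<omega>. (g e \<omega>)\<^sup>2)" "integrable M (\<lambda>\<omega>. (h e \<omega>)\<^sup>2)" "integrable M (\<lambda>\<omega>. g e \<omega> * h e \<omega>)"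
    "integrable M (\<lambda>\<omega>. (w e \<omega>)\<^sup>2)" "integrable M (w e)"
    and "(\<integral>\<omega>. (w e \<omega>)\<^sup>2 \<partial>M) = 1 - t\<^sup>2"
proof -
  note [measurable] = g_measurable[OF e] h_measurable[OF e]
  \<comment> \<open>A non-integrable function would have integral 0, whereas these second moments
    equal 1.\<close>
  show g: "integrable M (\<lambda>\<omega>. (g e \<omega>)\<^sup>2)" and h: "integrable M (\<lambda>\<omega>. (h e \<omega>)\<^sup>2)"
    using g_variance[OF e] h_variance[OF e] not_integrable_integral_eq by fastforce+
  show gh: "integrable M (\<lambda>\<omega>. g e \<omega> * h e \<omega>)"
  proof (rule Bochner_Integration.integrable_bound)
    show "integrable M (\<lambda>\<omega>. (g e \<omega>)\<^sup>2 + (h e \<omega>)\<^sup>2)" using g h by simp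
    show "AE \<omega> in M. norm (g e \<omega> * h e \<omega>) \<le> norm ((g e \<omega>)\<^sup>2 + (h e \<omega>)\<^sup>2)"
    proof (rule AE_I2)
      fix \<omega>
      show "norm (g e \<omega> * h e \<omega>) \<le> norm ((g e \<omega>)\<^sup>2 + (h e \<omega>)\<^sup>2)"
        using sum_squares_bound[of "\<bar>g e \<omega>\<bar>" "\<bar>h e \<omega>\<bar>"]
          mult_nonneg_nonneg[OF abs_ge_zero abs_ge_zero, of "g e \<omega>" "h e \<omega>"]
        by (simp add: abs_mult del: mult_nonneg_nonneg)
    qed
  qed simp
  have eq: "(w e \<omega>)\<^sup>2 = (g e \<omega>)\<^sup>2 + t\<^sup>2 * (h e \<omega>)\<^sup>2 - 2 * t * (g e \<omega> * h e \<omega>)" for \<omega>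
    by (simp add: power2_eq_square algebra_simps)
  show w2: "integrable M (\<lambda>\<omega>. (w e \<omega>)\<^sup>2)" unfolding eq using g h gh by simp
  show "(\<integral>\<omega>. (w e \<omega>)\<^sup>2 \<partial>M) = 1 - t\<^sup>2"
    unfolding eq using g h gh g_variance[OF e] h_variance[OF e] covariance[OF e]
    by (simp add: power2_eq_square)
  show "integrable M (w e)"
    by (rule square_integrable_imp_integrable[OF _ w2]) simp
qed

lemma integrable_w_mult:
  assumes "e \<in> E" "e' \<in> E"
  shows "integrable M (\<lambda>\<omega>. w e \<omega> * w e' \<omega>)"
proof (rule Bochner_Integration.integrable_bound)
  note [measurable] = g_measurable[OF assms(1)] h_measurable[OF assms(1)] g_measurable[OF assms(2)] h_measurable[OF assms(2)]
  show "integrable M (\<lambda>\<omega>. (w e \<omega>)\<^sup>2 + (w e' \<omega>)\<^sup>2)" using square_integrable(4) assms by simp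
  show "AE \<omega> in M. norm (w e \<omega> * w e' \<omega>) \<le> norm ((w e \<omega>)\<^sup>2 + (w e' \<omega>)\<^sup>2)"
  proof (rule AE_I2)
    fix \<omega>
    show "norm (w e \<omega> * w e' \<omega>) \<le> norm ((w e \<omega>)\<^sup>2 + (w e' \<omega>)\<^sup>2)"
      using sum_squares_bound[of "\<bar>w e \<omega>\<bar>" "\<bar>w e' \<omega>\<bar>"]
        mult_nonneg_nonneg[OF abs_ge_zero abs_ge_zero, of "w e \<omega>" "w e' \<omega>"]
      by (simp add: abs_mult del: mult_nonneg_nonneg)
  qed
  show "(\<lambda>\<omega>. w e \<omega> * w e' \<omega>) \<in> borel_measurable M" by measurable
qed

text \<open>The one-site formula applied in coordinate \<open>e\<close> with everything else frozen.
  The factor \<open>c\<close> may depend on the other sites: it is 1 in the main identity and the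
  weight of another site in \<open>decorrelated_products\<close>. The average under the second Gibbs
  measure depends on \<open>h e\<close>, but its derivative drops out because \<open>w e\<close> is
  uncorrelated with \<open>h e\<close>.\<close>

lemma disorder_integration_by_parts:
  fixes c :: "('e \<Rightarrow> real \<times> real) \<Rightarrow> real"
  assumes e: "e \<in> E" and k: "observable k" and l: "observable l"
    and c[measurable]: "c \<in> borel_measurable Pr" and const: "\<And>p y. c (p(e := y)) = c (p(e := 0))"
    and i: "integrable M (\<lambda>\<omega>. c (gauss \<omega>))" "integrable M (\<lambda>\<omega>. c (gauss \<omega>) * w e \<omega>)"
  shows "(\<integral>\<omega>. c (gauss \<omega>) * w e \<omega> * (E\<^sub>1 k \<omega> * E\<^sub>2 l \<omega>) \<partial>M) =
    (1 - t\<^sup>2) * \<gamma> * (\<integral>\<omega>. c (gauss \<omega>) * ((E\<^sub>1 (\<lambda>\<omega> \<sigma>. k \<omega> \<sigma> * f e \<omega> \<sigma>) \<omega> - E\<^sub>1 k \<omega> * E\<^sub>1 (f e) \<omega>) * E\<^sub>2 l \<omega>) \<partial>M)"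
proof -
  let ?u = "\<lambda>p e. fst (p e)" and ?v = "\<lambda>p e. snd (p e)" and ?kf = "\<lambda>\<omega> \<sigma>. k \<omega> \<sigma> * f e \<omega> \<sigma>"
  define D where "D \<omega> u = \<gamma> * (avg\<^sub>1 ?kf \<omega> u - avg\<^sub>1 k \<omega> u * avg\<^sub>1 (f e) \<omega> u)" for \<omega> u
  define \<Psi> where "\<Psi> \<omega> p = (fst (p e) - t * snd (p e)) * (avg\<^sub>1 k \<omega> (?u p) * avg\<^sub>2 l \<omega> (?v p))
      - (1 - t\<^sup>2) * (D \<omega> (?u p) * avg\<^sub>2 l \<omega> (?v p))" for \<omega> p
  \<comment> \<open>Both sides of the identity are packed into one integrand, so the claim becomes
    that a single integral vanishes, which can be tested on sections in coordinate
    \<open>e\<close>.\<close>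
  define \<Phi> where "\<Phi> z = c (snd z) * \<Psi> (fst z) (snd z)" for z
  note obs = k l observable_f[OF e] observable_mult[OF k observable_f[OF e]]
  have m[measurable]: "(\<lambda>z. fst (snd z e')) \<in> borel_measurable (R \<Otimes>\<^sub>M Pr)"
    "(\<lambda>z. snd (snd z e')) \<in> borel_measurable (R \<Otimes>\<^sub>M Pr)" if "e' \<in> E" for e'
    using that by measurable
  have mavg: "(\<lambda>z. avg\<^sub>1 k' (fst z) (?u (snd z))) \<in> borel_measurable (R \<Otimes>\<^sub>M Pr)"
    "(\<lambda>z. avg\<^sub>2 k' (fst z) (?v (snd z))) \<in> borel_measurable (R \<Otimes>\<^sub>M Pr)" if "observable k'" for k'
    using avg_measurable(1)[OF that measurable_fst, of "\<lambda>z. ?u (snd z)" Pr]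
      avg_measurable(2)[OF that measurable_fst, of "\<lambda>z. ?v (snd z)" Pr] m by simp_all
  have \<Phi>: "\<Phi> \<in> borel_measurable (R \<Otimes>\<^sub>M Pr)"
    unfolding \<Phi>_def \<Psi>_def D_def
    by (intro borel_measurable_times borel_measurable_diff borel_measurable_const mavg m obs e
        measurable_compose[OF measurable_snd c])
  have g: "avg\<^sub>1 k' \<omega> (?u (gauss \<omega>)) = E\<^sub>1 k' \<omega>" "avg\<^sub>2 k' \<omega> (?v (gauss \<omega>)) = E\<^sub>2 k' \<omega>" for k' \<omega>
    by (auto simp: gauss_def intro!: avg_cong)
  have we: "fst (gauss \<omega> e) - t * snd (gauss \<omega> e) = w e \<omega>" for \<omega>
    using e by (simp add: gauss_def)
  have \<Phi>_eq: "\<Phi> (\<omega>, gauss \<omega>) = c (gauss \<omega>) * w e \<omega> * (E\<^sub>1 k \<omega> * E\<^sub>2 l \<omega>)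
      - (1 - t\<^sup>2) * \<gamma> * (c (gauss \<omega>) * ((E\<^sub>1 ?kf \<omega> - E\<^sub>1 k \<omega> * E\<^sub>1 (f e) \<omega>) * E\<^sub>2 l \<omega>))" for \<omega>
    unfolding \<Phi>_def \<Psi>_def D_def fst_conv snd_conv we g by (simp add: algebra_simps)
  have i1: "integrable M (\<lambda>\<omega>. c (gauss \<omega>) * w e \<omega> * (E\<^sub>1 k \<omega> * E\<^sub>2 l \<omega>))"
    using E_measurable obs E_bound
    by (intro integrable_mult_bounded[OF i(2)]) (auto simp: abs_mult intro!: mult_le_one)
  have i2: "integrable M (\<lambda>\<omega>. c (gauss \<omega>) * ((E\<^sub>1 ?kf \<omega> - E\<^sub>1 k \<omega> * E\<^sub>1 (f e) \<omega>) * E\<^sub>2 l \<omega>))"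
  proof -
    have "integrable M (\<lambda>\<omega>. c (gauss \<omega>) * (E\<^sub>1 ?kf \<omega> * E\<^sub>2 l \<omega>))"
      "integrable M (\<lambda>\<omega>. c (gauss \<omega>) * (E\<^sub>1 k \<omega> * E\<^sub>1 (f e) \<omega> * E\<^sub>2 l \<omega>))"
      using E_measurable obs E_bound
      by (intro integrable_mult_bounded[OF i(1)]; auto simp: abs_mult intro!: mult_le_one)+
    from Bochner_Integration.integrable_diff[OF this] show ?thesis
      by (simp add: algebra_simps)
  qed
  have "(\<integral>\<omega>. \<Phi> (\<omega>, gauss \<omega>) \<partial>M) = 0"
  proof (rule integral_eq_0_by_resampling[OF \<Phi> _ e])
    show "integrable M (\<lambda>\<omega>. \<Phi> (\<omega>, gauss \<omega>))" unfolding \<Phi>_eq using i1 i2 by simp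
    fix \<omega> and p :: "'e \<Rightarrow> real \<times> real" assume w: "\<omega> \<in> space R"
    have up: "?u (p(e := y)) = (?u p)(e := fst y)" "?v (p(e := y)) = (?v p)(e := snd y)" for y
      by auto
    let ?\<phi> = "\<lambda>x. avg\<^sub>1 k \<omega> ((?u p)(e := x))" and ?\<psi> = "\<lambda>x. avg\<^sub>2 l \<omega> ((?v p)(e := x))"
    let ?D2 = "\<lambda>u. \<delta> * (avg\<^sub>2 (\<lambda>\<omega> \<sigma>. l \<omega> \<sigma> * f e \<omega> \<sigma>) \<omega> u - avg\<^sub>2 l \<omega> u * avg\<^sub>2 (f e) \<omega> u)"
    note obs' = obs observable_mult[OF l observable_f[OF e]]
    \<comment> \<open>A covariance of observables is at most 2 in absolute value, so the derivatives
      are at most \<open>2 * \<gamma>\<close> and \<open>2 * \<delta>\<close>; the summand 1 covers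
      the averages, since one constant must bound all four functions.\<close>
    have diff2: "\<bar>s * (a - b * d)\<bar> \<le> 1 + 2 * \<gamma> + 2 * \<delta>"
      if "\<bar>a\<bar> \<le> 1" "\<bar>b\<bar> \<le> 1" "\<bar>d\<bar> \<le> 1" "s = \<gamma> \<or> s = \<delta>" for s a b d :: real
    proof -
      have "\<bar>b * d\<bar> \<le> 1" using that by (auto simp: abs_mult intro: mult_le_one)
      then have "\<bar>a - b * d\<bar> \<le> 2" using that(1) by linarith
      then have "\<bar>s\<bar> * \<bar>a - b * d\<bar> \<le> \<bar>s\<bar> * 2" by (intro mult_left_mono) auto
      moreover have "\<bar>s\<bar> * 2 \<le> 1 + 2 * \<gamma> + 2 * \<delta>" using that(4) pos by auto
      ultimately show ?thesis unfolding abs_mult by linarith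
    qed
    have "(\<integral>z. (fst z - t * snd z) * (?\<phi> (fst z) * ?\<psi> (snd z))
        - (1 - t\<^sup>2) * (D \<omega> ((?u p)(e := fst z)) * ?\<psi> (snd z)) \<partial>K e) = 0"
    proof (rule correlated_gaussian_integration_by_parts[where \<psi>'="\<lambda>x. ?D2 ((?v p)(e := x))"
          and \<phi>=\<open>?\<phi>\<close> and \<psi>=\<open>?\<psi>\<close> and \<phi>'="\<lambda>x. D \<omega> ((?u p)(e := x))"
          and C="1 + 2 * \<gamma> + 2 * \<delta>"])
      show "correlated_gaussian t (K e)" using gaussian[OF e] K_eq[OF e] by simp
      show "(?\<phi> has_real_derivative D \<omega> ((?u p)(e := x))) (at x)" for x
        unfolding D_def by (rule avg\<^sub>1_deriv[OF k w e])
      show "(?\<psi> has_real_derivative ?D2 ((?v p)(e := x))) (at x)" for x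
        by (rule avg\<^sub>2_deriv[OF l w e])
      show "continuous_on UNIV (\<lambda>x. D \<omega> ((?u p)(e := x)))"
        unfolding D_def by (intro continuous_intros avg_continuous obs' w e)
      show "continuous_on UNIV (\<lambda>x. ?D2 ((?v p)(e := x)))"
        by (intro continuous_intros avg_continuous obs' w e)
      show "\<bar>D \<omega> ((?u p)(e := x))\<bar> \<le> 1 + 2 * \<gamma> + 2 * \<delta>" for x
        unfolding D_def by (intro diff2 avg_bound obs' w) simp
      show "\<bar>?D2 ((?v p)(e := x))\<bar> \<le> 1 + 2 * \<gamma> + 2 * \<delta>" for x
        by (intro diff2 avg_bound obs' w) simp
      show "\<bar>?\<phi> x\<bar> \<le> 1 + 2 * \<gamma> + 2 * \<delta>" for x
        using avg_bound(1)[OF k w, of "(?u p)(e := x)"] pos by linarith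
      show "\<bar>?\<psi> x\<bar> \<le> 1 + 2 * \<gamma> + 2 * \<delta>" for x
        using avg_bound(2)[OF l w, of "(?v p)(e := x)"] pos by linarith
    qed
    then have "(\<integral>y. \<Psi> \<omega> (p(e := y)) \<partial>K e) = 0"
      unfolding \<Psi>_def up by simp
    \<comment> \<open>Since \<open>c\<close> does not change with coordinate \<open>e\<close>, it
      leaves the inner integral as a constant.\<close>
    moreover have "\<Phi> (\<omega>, p(e := y)) = c (p(e := 0)) * \<Psi> \<omega> (p(e := y))" for y
      unfolding \<Phi>_def using const[of p y] by simp
    ultimately show "(\<integral>y. \<Phi> (\<omega>, p(e := y)) \<partial>K e) = 0" by simp
  qed
  then show ?thesis unfolding \<Phi>_eq using i1 i2 by simp
qed

lemma E\<^sub>1_1: "\<omega> \<in> space M \<Longrightarrow> E\<^sub>1 (\<lambda>_ _. 1) \<omega> = 1"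
  using prob_space.prob_space[OF gibbs_model.prob_space_G[OF model_1]] space_R by (simp add: avg\<^sub>1_def)

section \<open>Bound on the expected thermal variance\<close>

definition overlap_kernel :: "'e \<Rightarrow> 'e \<Rightarrow> 'w \<Rightarrow> 's \<Rightarrow> real" where
  "overlap_kernel e e' \<omega> \<sigma> = f e \<omega> \<sigma> * f e' \<omega> \<sigma>"

lemma observable_overlap_kernel: "e \<in> E \<Longrightarrow> e' \<in> E \<Longrightarrow> observable (overlap_kernel e e')"
  unfolding overlap_kernel_def[abs_def] by (intro observable_mult observable_f)

text \<open>On the diagonal the average is at most 1, which leaves the variance of the weight. Off
  the diagonal, integration by parts at \<open>e\<close> with \<open>k = 1\<close> and with
  \<open>w e'\<close> as the factor \<open>c\<close> gives the covariance of the constant 1 with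
  \<open>f e\<close> under \<open>G\<^sub>1\<close>, that is 0.\<close>

lemma decorrelated_products:
  assumes e: "e \<in> E" and e': "e' \<in> E"
  shows "(\<integral>\<omega>. w e \<omega> * w e' \<omega> * E\<^sub>2 (overlap_kernel e e') \<omega> \<partial>M) \<le> (if e = e' then 1 - t\<^sup>2 else 0)"
proof (cases "e = e'")
  case True
  let ?B = "E\<^sub>2 (overlap_kernel e e)"
  have "(\<integral>\<omega>. (w e \<omega>)\<^sup>2 * ?B \<omega> \<partial>M) \<le> (\<integral>\<omega>. (w e \<omega>)\<^sup>2 \<partial>M)"
  proof (rule integral_mono')
    fix \<omega> assume "\<omega> \<in> space M"
    then have "?B \<omega> \<le> 1" using E_bound(2)[OF observable_overlap_kernel[OF e e]] by (auto simp: abs_le_iff)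
    then show "(w e \<omega>)\<^sup>2 * ?B \<omega> \<le> (w e \<omega>)\<^sup>2" by (intro mult_left_le) auto
  qed (use square_integrable(4)[OF e] in auto)
  then show ?thesis using True square_integrable(6)[OF e] by (simp add: power2_eq_square)
next
  case False
  let ?c = "\<lambda>p. fst (p e') - t * snd (p e') :: real"
  have c: "?c (gauss \<omega>) = w e' \<omega>" for \<omega> using e' by (simp add: gauss_def)
  have mc: "?c \<in> borel_measurable Pr" using e' by measurable
  have "(\<integral>\<omega>. ?c (gauss \<omega>) * w e \<omega> * (E\<^sub>1 (\<lambda>_ _. 1) \<omega> * E\<^sub>2 (overlap_kernel e e') \<omega>) \<partial>M) =
      (1 - t\<^sup>2) * \<gamma> * (\<integral>\<omega>. ?c (gauss \<omega>) * ((E\<^sub>1 (\<lambda>\<omega> \<sigma>. 1 * f e \<omega> \<sigma>) \<omega> - E\<^sub>1 (\<lambda>_ _. 1) \<omega> * E\<^sub>1 (f e) \<omega>) *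
        E\<^sub>2 (overlap_kernel e e') \<omega>) \<partial>M)"
    by (rule disorder_integration_by_parts[OF e observable_1 observable_overlap_kernel[OF e e'] mc])
      (use False e e' square_integrable(5) integrable_w_mult c in auto)
  also have "(\<integral>\<omega>. ?c (gauss \<omega>) * ((E\<^sub>1 (\<lambda>\<omega> \<sigma>. 1 * f e \<omega> \<sigma>) \<omega> - E\<^sub>1 (\<lambda>_ _. 1) \<omega> * E\<^sub>1 (f e) \<omega>) *
        E\<^sub>2 (overlap_kernel e e') \<omega>) \<partial>M) = (\<integral>\<omega>. 0 \<partial>M)"
    by (intro Bochner_Integration.integral_cong refl) (simp add: E\<^sub>1_1)
  also have "(\<integral>\<omega>. ?c (gauss \<omega>) * w e \<omega> * (E\<^sub>1 (\<lambda>_ _. 1) \<omega> * E\<^sub>2 (overlap_kernel e e') \<omega>) \<partial>M) =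
      (\<integral>\<omega>. w e \<omega> * w e' \<omega> * E\<^sub>2 (overlap_kernel e e') \<omega> \<partial>M)"
    by (intro Bochner_Integration.integral_cong refl) (simp add: c E\<^sub>1_1)
  finally show ?thesis using False by simp
qed

definition first_variance :: "'w \<Rightarrow> real" where
  "first_variance \<omega> = thermal_variance E (\<lambda>e. f e \<omega>) (G\<^sub>1 \<omega> (\<lambda>e. g e \<omega>)) (G\<^sub>2 \<omega> (\<lambda>e. h e \<omega>))"

text \<open>The index order \<open>e' e\<close> is the one that arises when
  \<open>E\<^sub>1 (f e')\<close> is differentiated in the coupling at \<open>e\<close>.\<close>

lemma first_variance_eq:
  "first_variance \<omega> = (\<Sum>e\<in>E. \<Sum>e'\<in>E. (E\<^sub>1 (overlap_kernel e' e) \<omega> - E\<^sub>1 (f e') \<omega> * E\<^sub>1 (f e) \<omega>) *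
    E\<^sub>2 (overlap_kernel e e') \<omega>)"
  unfolding first_variance_def thermal_variance_def avg\<^sub>1_def avg\<^sub>2_def overlap_kernel_def
  by (simp add: mult.commute)

lemma integrable_first_variance_summand:
  assumes "e \<in> E" "e' \<in> E"
  shows "integrable M (\<lambda>\<omega>. (E\<^sub>1 (overlap_kernel e' e) \<omega> - E\<^sub>1 (f e') \<omega> * E\<^sub>1 (f e) \<omega>) * E\<^sub>2 (overlap_kernel e e') \<omega>)"
proof -
  note obs = observable_overlap_kernel observable_f
  have "integrable M (\<lambda>\<omega>. E\<^sub>1 (overlap_kernel e' e) \<omega> * E\<^sub>2 (overlap_kernel e e') \<omega>)"
    "integrable M (\<lambda>\<omega>. E\<^sub>1 (f e') \<omega> * E\<^sub>1 (f e) \<omega> * E\<^sub>2 (overlap_kernel e e') \<omega>)"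
    using E_measurable obs E_bound assms
    by (auto intro!: integrable_const_bound[where B=1] AE_I2 mult_le_one simp: abs_mult)
  from Bochner_Integration.integrable_diff[OF this] show ?thesis by (simp add: left_diff_distrib)
qed

lemma integrable_first_variance: "integrable M first_variance"
  unfolding first_variance_eq[abs_def] using integrable_first_variance_summand by simp

lemma gram_E\<^sub>2:
  assumes w: "\<omega> \<in> space M"
  shows "(\<Sum>e\<in>E. \<Sum>e'\<in>E. y e * z e' * E\<^sub>2 (overlap_kernel e e') \<omega>) =
    (\<integral>\<sigma>. (\<Sum>e\<in>E. y e * f e \<omega> \<sigma>) * (\<Sum>e\<in>E. z e * f e \<omega> \<sigma>) \<partial>G\<^sub>2 \<omega> (\<lambda>e. h e \<omega>))"
proof -
  interpret gibbs_model "\<nu> \<omega>" E "\<lambda>e. f e \<omega>" \<delta> using model_2 w space_R by simp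
  interpret G: prob_space "G (\<lambda>e. h e \<omega>)" by (rule prob_space_G)
  show ?thesis
    unfolding avg\<^sub>2_def overlap_kernel_def
    by (rule G.gram_sum_eq_integral[where C=1])
      (use F_measurable F_bound measurable_cong_sets[OF sets_G refl] in auto)
qed

text \<open>The double sum is an average of a product \<open>X Y\<close> over one replica of
  \<open>G\<^sub>2\<close> with \<open>\<bar>Y\<bar> \<le> card E\<close>, and \<bar>X\<bar> is at
  most half of X X / \<theta> + \<theta>. This makes the bound linear in the average of X X, whose
  expectation is controlled by \<open>decorrelated_products\<close>.\<close>

lemma disorder_sum_le:
  assumes w: "\<omega> \<in> space M" and l: "0 < \<theta>"
  shows "(\<Sum>e\<in>E. \<Sum>e'\<in>E. w e \<omega> * E\<^sub>1 (f e') \<omega> * E\<^sub>2 (overlap_kernel e e') \<omega>) \<le>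
    card E / 2 * ((\<Sum>e\<in>E. \<Sum>e'\<in>E. w e \<omega> * w e' \<omega> * E\<^sub>2 (overlap_kernel e e') \<omega>) / \<theta> + \<theta>)"
proof -
  interpret gibbs_model "\<nu> \<omega>" E "\<lambda>e. f e \<omega>" \<delta> using model_2 w space_R by simp
  interpret G: prob_space "G (\<lambda>e. h e \<omega>)" by (rule prob_space_G)
  let ?G = "G (\<lambda>e. h e \<omega>)" and ?N = "real (card E)"
  \<comment> \<open>\<open>?X\<close> is the weighted disorder sum at the replica, and
    \<open>?Y\<close> is \<open>card E\<close> times the overlap averaged over the other
    replica.\<close>
  let ?X = "\<lambda>\<sigma>. \<Sum>e\<in>E. w e \<omega> * f e \<omega> \<sigma>" and ?Y = "\<lambda>\<sigma>. \<Sum>e\<in>E. E\<^sub>1 (f e) \<omega> * f e \<omega> \<sigma>"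
  have mf[measurable]: "f e \<omega> \<in> borel_measurable ?G" if "e \<in> E" for e
    using F_measurable[OF that] measurable_cong_sets[OF sets_G refl] by blast
  have X: "\<bar>?X \<sigma>\<bar> \<le> (\<Sum>e\<in>E. \<bar>w e \<omega>\<bar>)" and Y: "\<bar>?Y \<sigma>\<bar> \<le> ?N" if s: "\<sigma> \<in> space ?G" for \<sigma>
  proof -
    have "\<bar>?X \<sigma>\<bar> \<le> (\<Sum>e\<in>E. \<bar>w e \<omega> * f e \<omega> \<sigma>\<bar>)" by (rule sum_abs)
    also have "\<dots> \<le> (\<Sum>e\<in>E. \<bar>w e \<omega>\<bar>)"
      using F_bound s by (intro sum_mono) (auto simp: abs_mult intro!: mult_left_le)
    finally show "\<bar>?X \<sigma>\<bar> \<le> (\<Sum>e\<in>E. \<bar>w e \<omega>\<bar>)" .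
    have "\<bar>?Y \<sigma>\<bar> \<le> (\<Sum>e\<in>E. \<bar>E\<^sub>1 (f e) \<omega> * f e \<omega> \<sigma>\<bar>)" by (rule sum_abs)
    also have "\<dots> \<le> (\<Sum>e\<in>E. 1)"
      using F_bound s E_bound(1)[OF observable_f w]
      by (intro sum_mono) (auto simp: abs_mult intro!: mult_le_one)
    finally show "\<bar>?Y \<sigma>\<bar> \<le> ?N" by simp
  qed
  have iX2: "integrable ?G (\<lambda>\<sigma>. ?X \<sigma> * ?X \<sigma>)"
  proof (rule G.integrable_const_bound[where B="(\<Sum>e\<in>E. \<bar>w e \<omega>\<bar>) * (\<Sum>e\<in>E. \<bar>w e \<omega>\<bar>)"])
    show "AE \<sigma> in ?G. norm (?X \<sigma> * ?X \<sigma>) \<le> (\<Sum>e\<in>E. \<bar>w e \<omega>\<bar>) * (\<Sum>e\<in>E. \<bar>w e \<omega>\<bar>)"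
      unfolding real_norm_def abs_mult using X by (intro AE_I2 mult_mono) (auto intro: sum_nonneg)
  qed (use mf in \<open>auto intro!: borel_measurable_times borel_measurable_sum\<close>)
  have "(\<Sum>e\<in>E. \<Sum>e'\<in>E. w e \<omega> * E\<^sub>1 (f e') \<omega> * E\<^sub>2 (overlap_kernel e e') \<omega>) = (\<integral>\<sigma>. ?X \<sigma> * ?Y \<sigma> \<partial>?G)"
    by (rule gram_E\<^sub>2[OF w])
  also have "\<dots> \<le> (\<integral>\<sigma>. ?N / 2 * (?X \<sigma> * ?X \<sigma> / \<theta> + \<theta>) \<partial>?G)"
  proof (rule integral_mono')
    show "integrable ?G (\<lambda>\<sigma>. ?N / 2 * (?X \<sigma> * ?X \<sigma> / \<theta> + \<theta>))"
      using iX2 by (intro integrable_mult_right Bochner_Integration.integrable_add integrable_divide) auto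
    show "0 \<le> ?N / 2 * (?X \<sigma> * ?X \<sigma> / \<theta> + \<theta>)" for \<sigma> using l by simp
    fix \<sigma> assume s: "\<sigma> \<in> space ?G"
    have amgm: "\<bar>x\<bar> \<le> (x * x / \<theta> + \<theta>) / 2" for x :: real
    proof -
      have "0 \<le> (\<bar>x\<bar> - \<theta>)\<^sup>2" by simp
      then have "2 * \<theta> * \<bar>x\<bar> \<le> x * x + \<theta> * \<theta>" by (simp add: power2_eq_square algebra_simps)
      then show ?thesis using l by (simp add: field_simps)
    qed
    have "?X \<sigma> * ?Y \<sigma> \<le> \<bar>?X \<sigma>\<bar> * \<bar>?Y \<sigma>\<bar>" by (simp only: abs_mult[symmetric] abs_ge_self)
    also have "\<dots> \<le> ((?X \<sigma> * ?X \<sigma> / \<theta> + \<theta>) / 2) * ?N"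
      using l by (intro mult_mono Y[OF s] amgm) auto
    finally show "?X \<sigma> * ?Y \<sigma> \<le> ?N / 2 * (?X \<sigma> * ?X \<sigma> / \<theta> + \<theta>)" by (simp only: mult.commute times_divide_eq_left times_divide_eq_right)
  qed
  also have "\<dots> = ?N / 2 * ((\<integral>\<sigma>. ?X \<sigma> * ?X \<sigma> \<partial>?G) / \<theta> + \<theta>)"
    using iX2 G.prob_space by simp
  also have "(\<integral>\<sigma>. ?X \<sigma> * ?X \<sigma> \<partial>?G) = (\<Sum>e\<in>E. \<Sum>e'\<in>E. w e \<omega> * w e' \<omega> * E\<^sub>2 (overlap_kernel e e') \<omega>)"
    by (rule gram_E\<^sub>2[OF w, symmetric])
  finally show ?thesis .
qed

lemma expectation_first_variance_le:
  "(1 / real (card E))\<^sup>2 * expectation first_variance \<le> 1 / (\<gamma> * sqrt (real (card E) * (1 - t)))"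
proof -
  let ?N = "real (card E)"
  \<comment> \<open>The sum over pairs of sites has expectation at most
    \<open>\<theta> * \<theta>\<close>; with this \<theta> the two terms of the arithmetic-geometric
    mean balance and add up to \<open>?N * \<theta>\<close>.\<close>
  define \<theta> where "\<theta> = sqrt (?N * (1 - t\<^sup>2))"
  have N: "0 < ?N" using finite_E nonempty_E by (simp add: card_gt_0_iff)
  have t2: "0 < 1 - t\<^sup>2" using t by (simp add: power_less_one_iff abs_square_less_1)
  have l: "0 < \<theta>" "\<theta> * \<theta> = ?N * (1 - t\<^sup>2)" using N t2 by (auto simp: \<theta>_def)
  have iw: "integrable M (\<lambda>\<omega>. w e \<omega> * E\<^sub>1 (f e') \<omega> * E\<^sub>2 (overlap_kernel e e') \<omega>)" if "e \<in> E" "e' \<in> E" for e e'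
    using square_integrable(5)[OF that(1)] observable_f[OF that(2)] observable_overlap_kernel[OF that]
    by (intro integrable_mult_bounded E_measurable E_bound)
  have iww: "integrable M (\<lambda>\<omega>. w e \<omega> * w e' \<omega> * E\<^sub>2 (overlap_kernel e e') \<omega>)" if "e \<in> E" "e' \<in> E" for e e'
    using observable_overlap_kernel[OF that]
    by (intro integrable_mult_bounded[OF integrable_w_mult[OF that]] E_measurable E_bound)
  \<comment> \<open>Integration by parts at site \<open>e\<close> with the observable
    \<open>f e'\<close> and the constant factor 1.\<close>
  have ibp: "(1 - t\<^sup>2) * \<gamma> * (\<integral>\<omega>. (E\<^sub>1 (overlap_kernel e' e) \<omega> - E\<^sub>1 (f e') \<omega> * E\<^sub>1 (f e) \<omega>) * E\<^sub>2 (overlap_kernel e e') \<omega> \<partial>M)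
      = (\<integral>\<omega>. w e \<omega> * E\<^sub>1 (f e') \<omega> * E\<^sub>2 (overlap_kernel e e') \<omega> \<partial>M)" if "e \<in> E" "e' \<in> E" for e e'
  proof -
    have kernel: "overlap_kernel e' e = (\<lambda>\<omega> \<sigma>. f e' \<omega> \<sigma> * f e \<omega> \<sigma>)"
      by (simp add: overlap_kernel_def fun_eq_iff)
    have "(\<integral>\<omega>. 1 * w e \<omega> * (E\<^sub>1 (f e') \<omega> * E\<^sub>2 (overlap_kernel e e') \<omega>) \<partial>M) =
        (1 - t\<^sup>2) * \<gamma> * (\<integral>\<omega>. 1 * ((E\<^sub>1 (overlap_kernel e' e) \<omega> - E\<^sub>1 (f e') \<omega> * E\<^sub>1 (f e) \<omega>) *
          E\<^sub>2 (overlap_kernel e e') \<omega>) \<partial>M)"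
      unfolding kernel
      by (rule disorder_integration_by_parts[OF that(1) observable_f[OF that(2)] observable_overlap_kernel[OF that]])
        (use square_integrable(5)[OF that(1)] in simp_all)
    then show ?thesis by (simp only: mult_1_left mult.assoc)
  qed
  have "(1 - t\<^sup>2) * \<gamma> * expectation first_variance =
      (\<integral>\<omega>. (\<Sum>e\<in>E. \<Sum>e'\<in>E. w e \<omega> * E\<^sub>1 (f e') \<omega> * E\<^sub>2 (overlap_kernel e e') \<omega>) \<partial>M)"
    unfolding first_variance_eq[abs_def]
    using integrable_first_variance_summand iw
    by (simp add: Bochner_Integration.integral_sum sum_distrib_left ibp cong: sum.cong)
  also have "\<dots> \<le> (\<integral>\<omega>. ?N / 2 * ((\<Sum>e\<in>E. \<Sum>e'\<in>E. w e \<omega> * w e' \<omega> * E\<^sub>2 (overlap_kernel e e') \<omega>) / \<theta> + \<theta>) \<partial>M)"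
    using iw iww disorder_sum_le[OF _ l(1)] by (intro integral_mono) auto
  also have "\<dots> = ?N / 2 * ((\<Sum>e\<in>E. \<Sum>e'\<in>E. \<integral>\<omega>. w e \<omega> * w e' \<omega> * E\<^sub>2 (overlap_kernel e e') \<omega> \<partial>M) / \<theta> + \<theta>)"
    using iww by (simp add: prob_space Bochner_Integration.integral_sum)
  also have "\<dots> \<le> ?N / 2 * ((\<Sum>e\<in>E. \<Sum>e'\<in>E. if e = e' then 1 - t\<^sup>2 else 0) / \<theta> + \<theta>)"
    using l(1) by (intro mult_left_mono add_right_mono divide_right_mono sum_mono decorrelated_products) auto
  also have "\<dots> = ?N * \<theta>"
    using finite_E l by (simp add: l(2)[symmetric])
  finally have *: "(1 - t\<^sup>2) * \<gamma> * expectation first_variance \<le> ?N * \<theta>" .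
  \<comment> \<open>One factor \<open>?N\<close> cancels, and the remaining
    \<open>?N * (1 - t\<^sup>2)\<close> is \<open>\<theta> * \<theta>\<close>, which leaves
    \<open>1 / (\<gamma> * \<theta>)\<close>.\<close>
  have "(1 / ?N)\<^sup>2 * expectation first_variance = ((1 - t\<^sup>2) * \<gamma> * expectation first_variance) / (?N * ?N * (1 - t\<^sup>2) * \<gamma>)"
    using N t2 pos by (simp add: power2_eq_square)
  also have "\<dots> \<le> (?N * \<theta>) / (?N * ?N * (1 - t\<^sup>2) * \<gamma>)"
    using * N t2 pos by (intro divide_right_mono) auto
  also have "\<dots> = \<theta> / (\<theta> * \<theta> * \<gamma>)" unfolding l(2) using N by simp
  also have "\<dots> = 1 / (\<gamma> * \<theta>)" using l(1) by simp
  \<comment> \<open>On [0, 1) the square of t is at most t, so \<theta> dominates the square root in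
    the claim.\<close>
  also have "\<dots> \<le> 1 / (\<gamma> * sqrt (?N * (1 - t)))"
  proof -
    have "t\<^sup>2 \<le> t" using t by (simp add: power2_eq_square mult_left_le)
    then have "sqrt (?N * (1 - t)) \<le> \<theta>" unfolding \<theta>_def using N by simp
    moreover have "0 < sqrt (?N * (1 - t))" using N t by simp
    ultimately show ?thesis using pos l(1)
      by (intro divide_left_mono) (auto intro!: mult_pos_pos mult_left_mono)
  qed
  finally show ?thesis .
qed

end

section \<open>The variance bound from the two roles of the coupled system\<close>

theorem theorem1:
  fixes M R :: "'w measure" and S :: "'s measure" and E :: "'e set"
    and f :: "'e \<Rightarrow> 'w \<Rightarrow> 's \<Rightarrow> real"
    and g\<^sub>1 g\<^sub>2 :: "'e \<Rightarrow> 'w \<Rightarrow> real"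
    and \<mu>\<^sub>1 \<mu>\<^sub>2 :: "'w \<Rightarrow> 's measure"
    and \<gamma>\<^sub>1 \<gamma>\<^sub>2 t :: real
  defines "G\<^sub>1 \<equiv> \<lambda>\<omega>. gibbs_measure \<gamma>\<^sub>1 (hamiltonian E (\<lambda>e. g\<^sub>1 e \<omega>) (\<lambda>e. f e \<omega>)) (\<mu>\<^sub>1 \<omega>)"
    and "G\<^sub>2 \<equiv> \<lambda>\<omega>. gibbs_measure \<gamma>\<^sub>2 (hamiltonian E (\<lambda>e. g\<^sub>2 e \<omega>) (\<lambda>e. f e \<omega>)) (\<mu>\<^sub>2 \<omega>)"
    and "Q \<equiv> \<lambda>\<omega>. overlap E (\<lambda>e. f e \<omega>)"
  assumes "prob_space M" and "finite E" and "E \<noteq> {}"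
    and "subalgebra M R"
    and "\<And>e. e \<in> E \<Longrightarrow> (\<lambda>(\<omega>, \<sigma>). f e \<omega> \<sigma>) \<in> borel_measurable (R \<Otimes>\<^sub>M S)"
    and "\<And>e \<omega> \<sigma>. e \<in> E \<Longrightarrow> \<omega> \<in> space M \<Longrightarrow> \<sigma> \<in> space S \<Longrightarrow> f e \<omega> \<sigma> \<in> {-1..1}"
    and "random_finite_measure R S \<mu>\<^sub>1" and "random_finite_measure R S \<mu>\<^sub>2"
    and "\<And>e. e \<in> E \<Longrightarrow> jointly_gaussian M (g\<^sub>1 e) (g\<^sub>2 e)"
    and "\<And>e. e \<in> E \<Longrightarrow> (\<integral>\<omega>. g\<^sub>1 e \<omega> \<partial>M) = 0" and "\<And>e. e \<in> E \<Longrightarrow> (\<integral>\<omega>. g\<^sub>2 e \<omega> \<partial>M) = 0"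
    and "\<And>e. e \<in> E \<Longrightarrow> (\<integral>\<omega>. (g\<^sub>1 e \<omega>)\<^sup>2 \<partial>M) = 1" and "\<And>e. e \<in> E \<Longrightarrow> (\<integral>\<omega>. (g\<^sub>2 e \<omega>)\<^sup>2 \<partial>M) = 1"
    and "\<And>e. e \<in> E \<Longrightarrow> (\<integral>\<omega>. g\<^sub>1 e \<omega> * g\<^sub>2 e \<omega> \<partial>M) = t"
    and "prob_space.indep_vars M (\<lambda>_. borel \<Otimes>\<^sub>M borel) (\<lambda>e \<omega>. (g\<^sub>1 e \<omega>, g\<^sub>2 e \<omega>)) E"
    and "prob_space.indep_set M (sets R)
           (sets (vimage_algebra (space M) (\<lambda>\<omega>. \<lambda>e\<in>E. (g\<^sub>1 e \<omega>, g\<^sub>2 e \<omega>))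
              (\<Pi>\<^sub>M e\<in>E. borel \<Otimes>\<^sub>M borel)))"
    and "\<gamma>\<^sub>1 > 0" and "\<gamma>\<^sub>2 > 0" and "0 \<le> t" and "t < 1"
  shows "(\<integral>\<omega>. gibbs_average (G\<^sub>1 \<omega>) (G\<^sub>2 \<omega>)
                (\<lambda>s. (Q \<omega> 1 1 s - gibbs_average (G\<^sub>1 \<omega>) (G\<^sub>2 \<omega>) (Q \<omega> 1 1))\<^sup>2) \<partial>M)
         \<le> 4 * (\<gamma>\<^sub>1 + \<gamma>\<^sub>2) / (\<gamma>\<^sub>1 * \<gamma>\<^sub>2 * sqrt (real (card E) * (1 - t)))"
proof -
  interpret prob_space M by fact
  have R: "space R = space M" "sets R \<subseteq> sets M" using \<open>subalgebra M R\<close> by (auto simp: subalgebra_def)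
  interpret A: coupled_gibbs M R S E f g\<^sub>1 g\<^sub>2 \<mu>\<^sub>1 \<mu>\<^sub>2 \<gamma>\<^sub>1 \<gamma>\<^sub>2 t
    using assms(5-) R
    by unfold_locales (auto intro: jointly_gaussian_imp_correlated_gaussian simp: jointly_gaussian_def abs_le_iff)
  interpret B: coupled_gibbs M R S E f g\<^sub>2 g\<^sub>1 \<mu>\<^sub>2 \<mu>\<^sub>1 \<gamma>\<^sub>2 \<gamma>\<^sub>1 t
    by (rule A.swapped)
  let ?N = "real (card E)"
  let ?V = "\<lambda>\<omega>. gibbs_average (G\<^sub>1 \<omega>) (G\<^sub>2 \<omega>)
    (\<lambda>s. (Q \<omega> 1 1 s - gibbs_average (G\<^sub>1 \<omega>) (G\<^sub>2 \<omega>) (Q \<omega> 1 1))\<^sup>2)"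
  have "(\<integral>\<omega>. ?V \<omega> \<partial>M) \<le> (\<integral>\<omega>. (1 / ?N)\<^sup>2 * (A.first_variance \<omega> + B.first_variance \<omega>) \<partial>M)"
  proof (rule integral_mono')
    show "integrable M (\<lambda>\<omega>. (1 / ?N)\<^sup>2 * (A.first_variance \<omega> + B.first_variance \<omega>))"
      using A.integrable_first_variance B.integrable_first_variance by simp
    fix \<omega> assume w: "\<omega> \<in> space M"
    then have wR: "\<omega> \<in> space R" using R by simp
    interpret m1: gibbs_model "\<mu>\<^sub>1 \<omega>" E "\<lambda>e. f e \<omega>" \<gamma>\<^sub>1 by (rule A.model_1[OF wR])
    interpret m2: gibbs_model "\<mu>\<^sub>2 \<omega>" E "\<lambda>e. f e \<omega>" \<gamma>\<^sub>2 by (rule A.model_2[OF wR])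
    show le: "?V \<omega> \<le> (1 / ?N)\<^sup>2 * (A.first_variance \<omega> + B.first_variance \<omega>)"
      unfolding A.first_variance_def B.first_variance_def G\<^sub>1_def G\<^sub>2_def Q_def
      using m1.F_measurable m1.F_bound m2.F_measurable m2.F_bound
        measurable_cong_sets[OF m1.sets_G refl] measurable_cong_sets[OF m2.sets_G refl]
      by (intro overlap_variance_le m1.prob_space_G m2.prob_space_G) auto
    have "0 \<le> ?V \<omega>" unfolding gibbs_average_def by (intro Bochner_Integration.integral_nonneg) simp
    with le show "0 \<le> (1 / ?N)\<^sup>2 * (A.first_variance \<omega> + B.first_variance \<omega>)" by simp
  qed
  also have "\<dots> = (1 / ?N)\<^sup>2 * expectation A.first_variance + (1 / ?N)\<^sup>2 * expectation B.first_variance"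
    using A.integrable_first_variance B.integrable_first_variance by (simp add: distrib_left)
  also have "\<dots> \<le> 1 / (\<gamma>\<^sub>1 * sqrt (?N * (1 - t))) + 1 / (\<gamma>\<^sub>2 * sqrt (?N * (1 - t)))"
    by (intro add_mono A.expectation_first_variance_le B.expectation_first_variance_le)
  also have "\<dots> = (\<gamma>\<^sub>1 + \<gamma>\<^sub>2) / (\<gamma>\<^sub>1 * \<gamma>\<^sub>2 * sqrt (?N * (1 - t)))"
  proof -
    have "1 / (a * s) + 1 / (b * s) = (a + b) / (a * b * s)" if "0 < a" "0 < b" for a b s :: real
      using that by (cases "s = 0") (auto simp: field_simps)
    then show ?thesis using A.pos by blast
  qed
  also have "\<dots> \<le> 4 * (\<gamma>\<^sub>1 + \<gamma>\<^sub>2) / (\<gamma>\<^sub>1 * \<gamma>\<^sub>2 * sqrt (?N * (1 - t)))"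
    using A.pos A.t by (intro divide_right_mono) auto
  finally show ?thesis .
qed

end
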